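(* Let $0 < p < 1$ and let $d \ge 2$ be an integer. There exist a constant $\varepsilon > 0$ and a symmetric probability distribution $\mu$ on $\mathrm{SL}_d(\mathbb{R})$ with finite $L^p$-moment, having no atoms and with support equal to $\mathrm{SL}_d(\mathbb{R})$, such that for every compact $K \subset \mathrm{SL}_{d}(\mathbb{R}) / \mathrm{SL}_{d}(\mathbb{Z})$, we have $$\liminf_{n \to +\infty} \frac{1}{n}\sum_{k = 1}^{n}\mu^{*k}(K \cdot \mathrm{SL}_{d}(\mathbb{Z})) \le 1 - \varepsilon .$$
   Context: A probability measure $\mu$ on $\mathrm{SL}_d(\mathbb{R})$ is symmetric if it is invariant under push-forward by $\gamma\mapsto\gamma^{-1}$. It has finite $L^p$-moment if $\int (\log \|g\|)^p\, d\mu(g)<\infty$, where $\|\cdot\|$ is the operator norm induced by the Euclidean norm on $\mathbb{R}^d$. $\mu^{*k}$ denotes the $k$-fold convolution of $\mu$. For $K\subset \mathrm{SL}_{d}(\mathbb{R}) / \mathrm{SL}_{d}(\mathbb{Z})$, $K\cdot \mathrm{SL}_d(\mathbb{Z})$ denotes the set $\{g\in \mathrm{SL}_d(\mathbb{R}) : g\,\mathrm{SL}_d(\mathbb{Z})\in K\}$ (the preimage of $K$). *)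

theory Defs
  imports "HOL-Probability.Probability"
begin

text \<open>
  The dimension \<open>d\<close> is \<open>CARD('n)\<close>, and \<open>real ^ 'n\<close> carries the Euclidean norm.
\<close>

definition SL :: "(real ^ 'n ^ 'n::finite) set"
  where "SL = {g. det g = 1}"

definition SL_int :: "(real ^ 'n ^ 'n::finite) set"
  where "SL_int = {g \<in> SL. \<forall>i j. g $ i $ j \<in> \<int>}"

abbreviation SL_top :: "(real ^ 'n ^ 'n::finite) topology"
  where "SL_top \<equiv> top_of_set SL"

definition SL_borel :: "(real ^ 'n ^ 'n::finite) measure"
  where "SL_borel = restrict_space borel SL"

definition SL_coset :: "real ^ 'n ^ 'n::finite \<Rightarrow> (real ^ 'n ^ 'n) set"
  where "SL_coset g = (\<lambda>\<gamma>. g ** \<gamma>) ` SL_int"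

definition SL_quotient :: "(real ^ 'n ^ 'n::finite) set topology"
  where "SL_quotient =
    topology (\<lambda>U. U \<subseteq> SL_coset ` SL \<and> openin SL_top {g \<in> SL. SL_coset g \<in> U})"

definition coset_preimage :: "(real ^ 'n ^ 'n::finite) set set \<Rightarrow> (real ^ 'n ^ 'n) set"
  where "coset_preimage K = {g \<in> SL. SL_coset g \<in> K}"

definition SL_prob :: "(real ^ 'n ^ 'n::finite) measure \<Rightarrow> bool"
  where "SL_prob \<mu> \<longleftrightarrow> prob_space \<mu> \<and> sets \<mu> = sets SL_borel"

definition symmetric_measure :: "(real ^ 'n ^ 'n::finite) measure \<Rightarrow> bool"
  where "symmetric_measure \<mu> \<longleftrightarrow> distr \<mu> SL_borel matrix_inv = \<mu>"

text \<open>
  On \<open>SL\<close> the operator norm is at least \<open>1\<close>, so the integrand is the \<open>p\<close>-th power of a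
  nonnegative number; where the logarithm vanishes, \<open>0 powr p = 0\<close>, as it should for \<open>p > 0\<close>.
\<close>

definition finite_Lp_moment :: "real \<Rightarrow> (real ^ 'n ^ 'n::finite) measure \<Rightarrow> bool"
  where "finite_Lp_moment p \<mu> \<longleftrightarrow>
    (\<integral>\<^sup>+ g. ennreal (ln (onorm ((*v) g)) powr p) \<partial>\<mu>) < \<infinity>"

definition no_atoms :: "'a measure \<Rightarrow> bool"
  where "no_atoms \<mu> \<longleftrightarrow> (\<forall>x \<in> space \<mu>. emeasure \<mu> {x} = 0)"

definition measure_support :: "'a::topological_space measure \<Rightarrow> 'a set"
  where "measure_support \<mu> =
    {x \<in> space \<mu>. \<forall>U. open U \<and> x \<in> U \<longrightarrow> 0 < emeasure \<mu> (U \<inter> space \<mu>)}"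

definition SL_conv ::
  "(real ^ 'n ^ 'n::finite) measure \<Rightarrow> (real ^ 'n ^ 'n) measure \<Rightarrow> (real ^ 'n ^ 'n) measure"
  where "SL_conv \<mu> \<nu> = distr (\<mu> \<Otimes>\<^sub>M \<nu>) SL_borel (\<lambda>(g, h). g ** h)"

primrec SL_conv_power ::
  "(real ^ 'n ^ 'n::finite) measure \<Rightarrow> nat \<Rightarrow> (real ^ 'n ^ 'n) measure"
  where
    "SL_conv_power \<mu> 0 = return SL_borel (mat 1)"
  | "SL_conv_power \<mu> (Suc k) = SL_conv (SL_conv_power \<mu> k) \<mu>"

lemma space_SL_borel [simp]: "space SL_borel = SL"
  by (simp add: SL_borel_def space_restrict_space)

lemma SL_mult: "g \<in> SL \<Longrightarrow> h \<in> SL \<Longrightarrow> g ** h \<in> SL"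
  by (simp add: SL_def det_mul)

text \<open>\<^const>\<open>topology\<close> is unspecified on predicates that are not topologies; this one is.\<close>

lemma openin_SL_quotient:
  "openin SL_quotient U \<longleftrightarrow>
     U \<subseteq> SL_coset ` SL \<and> openin SL_top {g \<in> SL. SL_coset g \<in> U}"
proof -
  have "istopology (\<lambda>U. U \<subseteq> SL_coset ` SL \<and>
      openin SL_top {g \<in> SL. SL_coset g \<in> U})" (is "istopology ?P")
    unfolding istopology_def
  proof (intro conjI allI impI)
    fix S T assume "?P S" "?P T"
    moreover have "{g \<in> SL. SL_coset g \<in> S \<inter> T} =
        {g \<in> SL. SL_coset g \<in> S} \<inter> {g \<in> SL. SL_coset g \<in> T}" by auto
    ultimately show "S \<inter> T \<subseteq> SL_coset ` SL"
      and "openin SL_top {g \<in> SL. SL_coset g \<in> S \<inter> T}" by auto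
  next
    fix \<K> assume *: "\<forall>U\<in>\<K>. ?P U"
    then show "\<Union>\<K> \<subseteq> SL_coset ` SL" by blast
    have "{g \<in> SL. SL_coset g \<in> \<Union>\<K>} = \<Union>((\<lambda>U. {g \<in> SL. SL_coset g \<in> U}) ` \<K>)"
      by blast
    moreover have "openin SL_top (\<Union>((\<lambda>U. {g \<in> SL. SL_coset g \<in> U}) ` \<K>))"
      using * by (intro openin_Union) blast
    ultimately show "openin SL_top {g \<in> SL. SL_coset g \<in> \<Union>\<K>}" by simp
  qed
  from topology_inverse'[OF this] show ?thesis
    unfolding SL_quotient_def by (rule fun_cong)
qed

lemma quotient_map_SL_coset:
  "quotient_map (SL_top :: (real^'n^'n::finite) topology) SL_quotient SL_coset"
proof -
  let ?Q = "SL_quotient :: (real^'n^'n) set topology"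
  let ?C = "SL_coset ` (SL :: (real^'n^'n) set)"
  have "{g \<in> SL. SL_coset g \<in> ?C} = SL" by blast
  then have "openin ?Q ?C" by (simp add: openin_SL_quotient)
  moreover have "topspace ?Q \<subseteq> ?C"
    using openin_SL_quotient openin_topspace by blast
  ultimately have "topspace ?Q = ?C"
    by (simp add: openin_subset subset_antisym)
  then show ?thesis
    by (simp add: quotient_map_def openin_SL_quotient)
qed

lemma measurable_SL_mult:
  "(\<lambda>(g, h). g ** h) \<in> SL_borel \<Otimes>\<^sub>M SL_borel \<rightarrow>\<^sub>M (SL_borel :: (real^'n^'n::finite) measure)"
proof -
  have "continuous_on UNIV (\<lambda>x::(real^'n^'n) \<times> (real^'n^'n). fst x ** snd x)"
    unfolding matrix_matrix_mult_def by (intro continuous_intros)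
  then have "(\<lambda>x. fst x ** snd x) \<in>
      borel_measurable (borel :: ((real^'n^'n) \<times> (real^'n^'n)) measure)"
    by (rule borel_measurable_continuous_onI)
  then have m: "(\<lambda>x. fst x ** snd x) \<in>
      (borel \<Otimes>\<^sub>M borel :: ((real^'n^'n) \<times> (real^'n^'n)) measure) \<rightarrow>\<^sub>M borel"
    by (simp add: borel_prod)
  have id: "(\<lambda>x. x) \<in> (SL_borel :: (real^'n^'n) measure) \<rightarrow>\<^sub>M borel"
    unfolding SL_borel_def by (rule measurable_restrict_space1) simp
  have "(\<lambda>x. (fst x, snd x)) \<in>
      SL_borel \<Otimes>\<^sub>M SL_borel \<rightarrow>\<^sub>M (borel \<Otimes>\<^sub>M borel :: ((real^'n^'n) \<times> (real^'n^'n)) measure)"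
    by (intro measurable_Pair measurable_compose[OF measurable_fst id]
        measurable_compose[OF measurable_snd id])
  from measurable_compose[OF this m]
  have "(\<lambda>x. fst x ** snd x) \<in> SL_borel \<Otimes>\<^sub>M SL_borel \<rightarrow>\<^sub>M (borel :: (real^'n^'n) measure)"
    by simp
  then have "(\<lambda>x. fst x ** snd x) \<in> SL_borel \<Otimes>\<^sub>M SL_borel \<rightarrow>\<^sub>M (SL_borel :: (real^'n^'n) measure)"
    unfolding SL_borel_def[where 'n='n]
    by (intro measurable_restrict_space2)
      (auto simp: space_pair_measure SL_mult simp flip: SL_borel_def)
  then show ?thesis by (simp add: case_prod_unfold)
qed

lemma SL_prob_conv:
  fixes \<mu> \<nu> :: "(real ^ 'n ^ 'n::finite) measure"
  assumes "SL_prob \<mu>" "SL_prob \<nu>"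
  shows "SL_prob (SL_conv \<mu> \<nu>)"
proof -
  interpret M: prob_space \<mu> using assms by (simp add: SL_prob_def)
  interpret N: prob_space \<nu> using assms by (simp add: SL_prob_def)
  interpret P: pair_prob_space \<mu> \<nu> ..
  have "sets (\<mu> \<Otimes>\<^sub>M \<nu>) = sets (SL_borel \<Otimes>\<^sub>M SL_borel)"
    using assms by (intro sets_pair_measure_cong) (auto simp: SL_prob_def)
  then have "(\<lambda>(g, h). g ** h) \<in> \<mu> \<Otimes>\<^sub>M \<nu> \<rightarrow>\<^sub>M (SL_borel :: (real^'n^'n) measure)"
    using measurable_SL_mult measurable_cong_sets by blast
  from P.prob_space_distr[OF this] show ?thesis
    by (simp add: SL_prob_def SL_conv_def)
qed

lemma SL_prob_conv_power:
  assumes "SL_prob \<mu>"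
  shows "SL_prob (SL_conv_power \<mu> k)"
proof (induction k)
  case 0
  then show ?case
    by (auto simp: SL_prob_def SL_def intro!: prob_space_return)
next
  case (Suc k)
  then show ?case using assms by (simp add: SL_prob_conv)
qed

end

theory Submission
  imports Defs
begin

text \<open>
  A random step is \<open>R l ** unip a b s\<close> or its inverse, where the index \<open>l\<close> has probability
  proportional to \<open>1 / e l ^ c\<close> for a very rapidly growing sequence \<open>e\<close>, and \<open>s\<close> is a random
  Liouville-type number: its law has no atoms, yet for every \<open>i\<close> it is extremely close to
  fractions with denominator \<open>2 ^ e i\<close>. For even \<open>i\<close> the matrix \<open>R i\<close> is diagonal with entries
  \<open>2 ^ - T i\<close>, \<open>2 ^ T i\<close>, \<open>1\<close>, ..., where \<open>T i\<close> is much larger than \<open>e i ^ c\<close>, the typical waiting time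
  for index \<open>i\<close>; the matrices of odd index are rational and dense, which gives full support.

  Among the first \<open>e i ^ c\<close> steps it has probability bounded below that exactly one step uses
  the index \<open>i\<close> (and is not inverted) while all others use smaller indices. The product of the
  smaller steps to the right of the big one is then so close to a rational matrix \<open>q\<close> of moderate
  height that a multiple of \<open>q\<inverse>\<close> applied to the contracted basis vector is an integer vector which
  the whole product maps to a very short one, so the coset of the product has left any given compact set.
\<close>

section \<open>Quantitative rational approximation of matrices\<close>

text \<open>An upper bound for the operator norm, in a pointwise form in which sums, products and
  weakenings combine directly.\<close>

definition mbound :: "real ^ 'n ^ 'n::finite \<Rightarrow> real \<Rightarrow> bool"
  where "mbound A c \<longleftrightarrow> (\<forall>v. norm (A *v v) \<le> c * norm v)"

lemma mboundD: "mbound A c \<Longrightarrow> norm (A *v v) \<le> c * norm v"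
  by (simp add: mbound_def)

lemma mbound_nonneg:
  assumes "mbound A c" shows "0 \<le> c"
proof -
  have "0 \<le> norm (A *v axis undefined 1)" by simp
  also have "\<dots> \<le> c" using mboundD[OF assms, of "axis undefined 1"] by simp
  finally show ?thesis .
qed

lemma mbound_mono: "mbound A c \<Longrightarrow> c \<le> d \<Longrightarrow> mbound A d"
  unfolding mbound_def by (meson mult_right_mono norm_ge_zero order_trans)

lemma mbound_mult:
  assumes "mbound A c" "mbound B d" shows "mbound (A ** B) (c * d)"
  unfolding mbound_def
proof
  fix v
  have "norm (A *v (B *v v)) \<le> c * norm (B *v v)" by (rule mboundD[OF assms(1)])
  also have "\<dots> \<le> c * (d * norm v)"
    using mbound_nonneg[OF assms(1)] mboundD[OF assms(2)] by (intro mult_left_mono)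
  finally show "norm (A ** B *v v) \<le> c * d * norm v"
    by (simp add: matrix_vector_mul_assoc mult.assoc)
qed

lemma mbound_add:
  assumes "mbound A c" "mbound B d" shows "mbound (A + B) (c + d)"
  unfolding mbound_def
proof
  fix v
  show "norm ((A + B) *v v) \<le> (c + d) * norm v"
    using mboundD[OF assms(1), of v] mboundD[OF assms(2), of v] norm_triangle_ineq[of "A *v v" "B *v v"]
    by (simp add: matrix_vector_mult_add_rdistrib distrib_right)
qed

lemma mbound_id: "1 \<le> c \<Longrightarrow> mbound (mat 1) c"
  unfolding mbound_def using mult_right_mono[of 1 c] by auto

lemma mbound_onorm: "mbound A (onorm ((*v) A))"
  unfolding mbound_def by (simp add: onorm)

lemma onorm_le_mbound: "mbound A c \<Longrightarrow> onorm ((*v) A) \<le> c"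
  unfolding mbound_def by (rule onorm_le) simp

text \<open>Compares the norm that defines the topology with the operator norm: each entry is at
  most \<open>norm A\<close> in absolute value, and there are as many entries as the square of the
  dimension.\<close>

lemma mbound_norm:
  fixes A :: "real ^ 'n ^ 'n::finite"
  shows "mbound A (real CARD('n) * real CARD('n) * norm A)"
proof -
  have "\<bar>A $ i $ j\<bar> \<le> norm A" for i j
    using component_le_norm_cart[of "A $ i" j] Finite_Cartesian_Product.norm_nth_le[of A i] by (auto intro: order_trans)
  then show ?thesis
    by (intro mbound_mono[OF mbound_onorm] onorm_le_matrix_component)
qed

text \<open>A relation rather than the function \<open>matrix_inv\<close>, so that the explicit
  inverses of elementary matrices and of products can be carried along.\<close>

definition is_inverse :: "real ^ 'n ^ 'n::finite \<Rightarrow> real ^ 'n ^ 'n \<Rightarrow> bool"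
  where "is_inverse A B \<longleftrightarrow> A ** B = mat 1 \<and> B ** A = mat 1"

lemma is_inverse_sym: "is_inverse A B \<Longrightarrow> is_inverse B A"
  by (simp add: is_inverse_def)

lemma is_inverse_mult:
  assumes "is_inverse A A'" "is_inverse B B'" shows "is_inverse (A ** B) (B' ** A')"
proof -
  have "A ** B ** (B' ** A') = A ** (B ** B') ** A'" "B' ** A' ** (A ** B) = B' ** (A' ** A) ** B"
    by (simp_all add: matrix_mul_assoc)
  then show ?thesis using assms by (simp add: is_inverse_def)
qed

lemma matrix_inv_eq:
  assumes "is_inverse A B" shows "matrix_inv A = B"
proof -
  have "A ** matrix_inv A = mat 1 \<and> matrix_inv A ** A = mat 1"
    unfolding matrix_inv_def
    by (rule someI_ex) (use assms in \<open>auto simp: is_inverse_def\<close>)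
  then have "B = B ** (A ** matrix_inv A)" by simp
  also have "\<dots> = matrix_inv A" using assms by (simp add: is_inverse_def matrix_mul_assoc)
  finally show ?thesis by simp
qed

lemma is_inverse_det:
  assumes "is_inverse A B" "A \<in> SL" shows "B \<in> SL"
  using assms det_mul[of A B] by (simp add: is_inverse_def SL_def)

lemma SL_is_inverse:
  assumes "A \<in> SL" shows "is_inverse A (matrix_inv A)"
proof -
  obtain B where B: "is_inverse A B"
    using assms invertible_det_nz[of A] unfolding SL_def is_inverse_def invertible_def by auto
  with matrix_inv_eq[OF B] show ?thesis by simp
qed

lemma matrix_inv_SL: "A \<in> SL \<Longrightarrow> matrix_inv A \<in> SL"
  using SL_is_inverse is_inverse_det by blast

section \<open>Heights of rational matrices\<close>

definition integral_mat :: "real ^ 'n ^ 'n::finite \<Rightarrow> bool"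
  where "integral_mat A \<longleftrightarrow> (\<forall>i j. A $ i $ j \<in> \<int>)"

lemma integral_mat_mult:
  assumes "integral_mat (c *\<^sub>R A)" "integral_mat (d *\<^sub>R B)"
  shows "integral_mat ((c * d) *\<^sub>R (A ** B))"
proof -
  have "((c * d) *\<^sub>R (A ** B)) $ i $ j = (\<Sum>k\<in>UNIV. (c *\<^sub>R A) $ i $ k * (d *\<^sub>R B) $ k $ j)" for i j
    by (simp add: matrix_matrix_mult_def sum_distrib_left mult_ac)
  moreover have "(\<Sum>k\<in>UNIV. (c *\<^sub>R A) $ i $ k * (d *\<^sub>R B) $ k $ j) \<in> \<int>" for i j
    using assms unfolding integral_mat_def by (intro Ints_sum Ints_mult) blast+
  ultimately show ?thesis unfolding integral_mat_def by metis
qed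

text \<open>A single number controls the denominators and the norms of both \<open>q\<close> and its
  inverse, which makes the notion symmetric under inversion and submultiplicative. The inverse
  matters because short vectors are found as integer multiples of its columns.\<close>

definition height_le :: "real ^ 'n ^ 'n::finite \<Rightarrow> real \<Rightarrow> bool"
  where "height_le q H \<longleftrightarrow> (\<exists>q' (E::nat). is_inverse q q' \<and> 0 < E \<and> real E \<le> H \<and>
    integral_mat (real E *\<^sub>R q) \<and> integral_mat (real E *\<^sub>R q') \<and> mbound q H \<and> mbound q' H)"

lemma height_le_ge1: "height_le q H \<Longrightarrow> 1 \<le> H"
  unfolding height_le_def by fastforce

lemma height_le_mono: "height_le q H \<Longrightarrow> H \<le> H' \<Longrightarrow> height_le q H'"
  unfolding height_le_def by (meson mbound_mono order_trans)

lemma height_le_mbound: "height_le q H \<Longrightarrow> mbound q H"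
  unfolding height_le_def by blast

lemma height_le_inverse:
  assumes "height_le q H" "is_inverse q q'" shows "height_le q' H"
proof -
  obtain q'' E where *: "is_inverse q q''" "0 < E" "real E \<le> H"
    "integral_mat (real E *\<^sub>R q)" "integral_mat (real E *\<^sub>R q'')" "mbound q H" "mbound q'' H"
    using assms(1) unfolding height_le_def by blast
  have "q'' = q'" using matrix_inv_eq[OF *(1)] matrix_inv_eq[OF assms(2)] by simp
  then show ?thesis unfolding height_le_def using * is_inverse_sym by blast
qed

lemma height_le_mult:
  assumes "height_le q H" "height_le r K" shows "height_le (q ** r) (H * K)"
proof -
  obtain q' E where q: "is_inverse q q'" "0 < E" "real E \<le> H"
    "integral_mat (real E *\<^sub>R q)" "integral_mat (real E *\<^sub>R q')" "mbound q H" "mbound q' H"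
    using assms(1) unfolding height_le_def by blast
  obtain r' F where r: "is_inverse r r'" "0 < F" "real F \<le> K"
    "integral_mat (real F *\<^sub>R r)" "integral_mat (real F *\<^sub>R r')" "mbound r K" "mbound r' K"
    using assms(2) unfolding height_le_def by blast
  have "real (E * F) \<le> H * K" using q(3) r(3) by (simp add: mult_mono)
  moreover have "integral_mat (real (E * F) *\<^sub>R (q ** r))" "integral_mat (real (E * F) *\<^sub>R (r' ** q'))"
    using integral_mat_mult[OF q(4) r(4)] integral_mat_mult[OF r(5) q(5)] by (simp_all add: mult.commute)
  moreover have "mbound (q ** r) (H * K)" "mbound (r' ** q') (H * K)"
    using mbound_mult[OF q(6) r(6)] mbound_mult[OF r(7) q(7)] by (simp_all add: mult.commute)
  ultimately show ?thesis
    unfolding height_le_def using is_inverse_mult[OF q(1) r(1)] q(2) r(2)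
    by (intro exI[of _ "r' ** q'"] exI[of _ "E * F"]) simp
qed

lemma height_le_id: "height_le (mat 1) 1"
  unfolding height_le_def
  by (intro exI[of _ "mat 1"] exI[of _ 1]) (simp add: is_inverse_def integral_mat_def mbound_id, simp add: mat_def)

section \<open>Matrices close to rational ones\<close>

definition near_rat :: "real ^ 'n ^ 'n::finite \<Rightarrow> real \<Rightarrow> real \<Rightarrow> bool"
  where "near_rat A H \<eta> \<longleftrightarrow> (\<exists>q. height_le q H \<and> mbound A H \<and> mbound (A - q) \<eta>)"

text \<open>The error telescopes: the error of \<open>B\<close> is multiplied by the norm of
  \<open>A\<close>, and the error of \<open>A\<close> by the norm of the rational approximant of
  \<open>B\<close>.\<close>

lemma near_rat_mult:
  assumes "near_rat A H \<eta>" "near_rat B K \<kappa>"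
  shows "near_rat (A ** B) (H * K) (H * \<kappa> + \<eta> * K)"
proof -
  obtain q r where q: "height_le q H" "mbound A H" "mbound (A - q) \<eta>"
    and r: "height_le r K" "mbound B K" "mbound (B - r) \<kappa>"
    using assms unfolding near_rat_def by blast
  have "A ** B - q ** r = A ** (B - r) + (A - q) ** r"
    by (simp add: matrix_eq matrix_vector_mult_diff_rdistrib matrix_vector_mult_diff_distrib
        matrix_vector_mult_add_rdistrib flip: matrix_vector_mul_assoc)
  moreover have "mbound \<dots> (H * \<kappa> + \<eta> * K)"
    by (intro mbound_add mbound_mult q r height_le_mbound)
  ultimately show ?thesis
    unfolding near_rat_def using height_le_mult[OF q(1) r(1)] mbound_mult[OF q(2) r(2)] by metis
qed

text \<open>Induction step for products of similar factors. The new contribution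
  \<open>M ^ j * \<eta>\<close> is enlarged by a factor \<open>M \<ge> 1\<close>, which keeps the
  closed form of the error.\<close>

lemma near_rat_power_mult:
  assumes "near_rat A (M ^ j) (real j * \<eta> * M ^ j)" "near_rat B M \<eta>"
  shows "near_rat (A ** B) (M ^ Suc j) (real (Suc j) * \<eta> * M ^ Suc j)"
proof -
  have M: "1 \<le> M" and \<eta>: "0 \<le> \<eta>"
    using assms(2) height_le_ge1 mbound_nonneg unfolding near_rat_def by blast+
  have *: "near_rat (A ** B) (M ^ j * M) (M ^ j * \<eta> + (real j * \<eta> * M ^ j) * M)"
    by (rule near_rat_mult[OF assms])
  have "M ^ j * \<eta> \<le> M ^ j * \<eta> * M"
    using mult_left_mono[OF M, of "M ^ j * \<eta>"] M \<eta> by simp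
  then have "M ^ j * \<eta> + (real j * \<eta> * M ^ j) * M \<le> real (Suc j) * \<eta> * M ^ Suc j"
    by (simp add: algebra_simps)
  with * show ?thesis
    unfolding near_rat_def by (auto intro: mbound_mono simp: mult.commute)
qed

lemma near_rat_id: "near_rat (mat 1) (M ^ 0) (real 0 * \<eta> * M ^ 0)"
  unfolding near_rat_def
  by (intro exI[of _ "mat 1"]) (auto simp: height_le_id mbound_id mbound_def)

section \<open>Elementary unipotent matrices \<open>1 + s E_ab\<close> and diagonal boosts\<close>

definition unip :: "'n \<Rightarrow> 'n \<Rightarrow> real \<Rightarrow> real ^ 'n ^ 'n::finite"
  where "unip a b s = (\<chi> i j. (if i = j then 1 else 0) + (if i = a \<and> j = b then s else 0))"

lemma unip_mult_vec: "unip a b s *v v = v + (s * v $ b) *\<^sub>R axis a 1"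
proof -
  have "(unip a b s *v v) $ i = (\<Sum>j\<in>UNIV. if i = j then v $ j else 0)
      + (\<Sum>j\<in>UNIV. if b = j then (if i = a then s * v $ j else 0) else 0)" for i
    unfolding sum.distrib[symmetric] matrix_vector_mult_def unip_def vec_lambda_beta
    by (intro sum.cong) (auto simp: algebra_simps)
  then have "(unip a b s *v v) $ i = (v + (s * v $ b) *\<^sub>R axis a 1) $ i" for i
    by (simp add: axis_def algebra_simps)
  then show ?thesis by (simp add: vec_eq_iff)
qed

lemma unip_add:
  assumes "a \<noteq> b" shows "unip a b s ** unip a b t = unip a b (s + t)"
  using assms
  by (simp add: matrix_eq unip_mult_vec axis_def algebra_simps flip: matrix_vector_mul_assoc)

lemma unip_0: "unip a b 0 = mat 1"
  by (simp add: matrix_eq unip_mult_vec)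

lemma unip_inverse: "a \<noteq> b \<Longrightarrow> is_inverse (unip a b s) (unip a b (- s))"
  by (simp add: is_inverse_def unip_add unip_0)

lemma unip_inj:
  assumes "unip a b s = unip a b t" "a \<noteq> b" shows "s = t"
proof -
  have "unip a b s $ a $ b = unip a b t $ a $ b" using assms(1) by simp
  then show ?thesis using assms(2) by (simp add: unip_def)
qed

text \<open>The matrix arises from the identity by adding \<open>s\<close> times row
  \<open>b\<close> to row \<open>a\<close>, and such a row operation preserves the
  determinant.\<close>

lemma unip_SL:
  fixes a b :: "'n::finite"
  assumes "a \<noteq> b" shows "unip a b s \<in> SL"
proof -
  have "unip a b s = (\<chi> k. if k = a then row a (mat 1) + s *s row b (mat 1) else row k (mat 1))"
    using assms by (auto simp: unip_def vec_eq_iff row_def mat_def)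
  then show ?thesis using det_row_operation[OF assms, of "mat 1 :: real^'n^'n" s] by (simp add: SL_def)
qed

lemma unip_diff: "mbound (unip a b s - unip a b t) \<bar>s - t\<bar>"
  unfolding mbound_def
proof
  fix v
  have "(unip a b s - unip a b t) *v v = ((s - t) * v $ b) *\<^sub>R axis a 1"
    by (simp add: matrix_vector_mult_diff_rdistrib unip_mult_vec algebra_simps)
  then show "norm ((unip a b s - unip a b t) *v v) \<le> \<bar>s - t\<bar> * norm v"
    using component_le_norm_cart[of v b] by (simp add: abs_mult mult_left_mono)
qed

lemma mbound_unip: "mbound (unip a b s) (1 + \<bar>s\<bar>)"
  using mbound_add[OF mbound_id[of 1] unip_diff[of a b s 0]] by (simp add: unip_0)

text \<open>The inverse has parameter \<open>- s\<close> and hence the same denominator. The factor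
  \<open>2\<close> absorbs the norm bound \<open>1 + \<bar>s\<bar>\<close>.\<close>

lemma height_le_unip:
  assumes "a \<noteq> b" "real E * s \<in> \<int>" "\<bar>s\<bar> \<le> 1" "0 < E"
  shows "height_le (unip a b s) (2 * real E)"
proof -
  have int: "integral_mat (real E *\<^sub>R unip a b t)" if "real E * t \<in> \<int>" for t
    using that by (auto simp: integral_mat_def unip_def distrib_left)
  have "1 + \<bar>s\<bar> \<le> 2 * real E" using assms(3,4) by linarith
  with int[OF assms(2)] int[of "-s"] assms(2,4) show ?thesis
    unfolding height_le_def using unip_inverse[OF assms(1), of s]
      mbound_mono[OF mbound_unip[of a b s]] mbound_mono[OF mbound_unip[of a b "-s"]]
    by (intro exI[of _ "unip a b (-s)"] exI[of _ E]) simp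
qed

text \<open>For \<open>t > 1\<close> and \<open>a \<noteq> b\<close> this contracts axis
  \<open>a\<close> and expands axis \<open>b\<close> by the same factor, so the determinant is one
  and exchanging \<open>a\<close> and \<open>b\<close> gives the inverse.\<close>

definition boost :: "'n \<Rightarrow> 'n \<Rightarrow> real \<Rightarrow> real ^ 'n ^ 'n::finite"
  where "boost a b t = (\<chi> i j. if i = j then (if i = a then 1 / t else if i = b then t else 1) else 0)"

lemma boost_mult_vec:
  "boost a b t *v v = (\<chi> i. (if i = a then 1 / t else if i = b then t else 1) * v $ i)"
proof -
  have "(boost a b t *v v) $ i
      = (\<Sum>j\<in>UNIV. if i = j then (if i = a then 1 / t else if i = b then t else 1) * v $ j else 0)" for i
    unfolding matrix_vector_mult_def boost_def vec_lambda_beta by (intro sum.cong) auto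
  then show ?thesis by (simp add: vec_eq_iff)
qed

lemma boost_inverse: "t \<noteq> 0 \<Longrightarrow> a \<noteq> b \<Longrightarrow> is_inverse (boost a b t) (boost b a t)"
  by (auto simp: is_inverse_def matrix_eq boost_mult_vec vec_eq_iff simp flip: matrix_vector_mul_assoc)

lemma boost_SL:
  assumes "a \<noteq> b" "t \<noteq> 0" shows "boost a b t \<in> SL"
proof -
  have "det (boost a b t) = (\<Prod>i\<in>UNIV. (if i = a then 1 / t else if i = b then t else 1))"
    by (subst det_diagonal) (auto simp: boost_def)
  also have "\<dots> = (\<Prod>i\<in>UNIV. (if i = a then 1 / t else 1) * (if i = b then t else 1))"
    using assms by (intro prod.cong) auto
  also have "\<dots> = 1" using assms by (simp add: prod.distrib)
  finally show ?thesis by (simp add: SL_def)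
qed

lemma mbound_boost:
  assumes "1 \<le> t" shows "mbound (boost a b t) t"
  unfolding mbound_def
proof
  fix v
  have "norm (boost a b t *v v) \<le> norm (t *\<^sub>R v)"
  proof (rule norm_le_componentwise_cart)
    fix i
    have "\<bar>if i = a then 1 / t else if i = b then t else 1\<bar> \<le> t"
      using assms order_trans[of "1 / t" 1 t] by auto
    then show "norm ((boost a b t *v v) $ i) \<le> norm ((t *\<^sub>R v) $ i)"
      using assms by (simp add: boost_mult_vec abs_mult mult_right_mono del: abs_divide)
  qed
  with assms show "norm (boost a b t *v v) \<le> t * norm v" by simp
qed

lemma height_le_boost:
  assumes "a \<noteq> b" shows "height_le (boost a b (2 ^ T)) (2 ^ T)"
proof -
  have "integral_mat (real (2 ^ T) *\<^sub>R boost c d (2 ^ T))" for c d :: 'a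
    by (auto simp: integral_mat_def boost_def)
  then show ?thesis
    unfolding height_le_def using boost_inverse[OF _ assms, of "2 ^ T"]
    by (intro exI[of _ "boost b a (2 ^ T)"] exI[of _ "2 ^ T"]) (auto intro!: mbound_boost)
qed

lemma boost_contracts: "boost a b t *v axis a 1 = (1 / t) *\<^sub>R axis a 1"
  by (auto simp: boost_mult_vec vec_eq_iff axis_def)

section \<open>Short vectors, compact sets and rational density\<close>

definition int_vec :: "real ^ 'n::finite \<Rightarrow> bool"
  where "int_vec v \<longleftrightarrow> (\<forall>i. v $ i \<in> \<int>)"

lemma int_vec_mult:
  assumes "integral_mat A" "int_vec v" shows "int_vec (A *v v)"
  using assms unfolding int_vec_def integral_mat_def matrix_vector_mult_def
  by (auto intro!: Ints_sum Ints_mult)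

lemma int_vec_norm_ge1:
  assumes "int_vec v" "v \<noteq> 0" shows "1 \<le> norm v"
proof -
  obtain i where "v $ i \<noteq> 0" using assms(2) by (auto simp: vec_eq_iff)
  then have "1 \<le> \<bar>v $ i\<bar>"
    using assms(1) Ints_nonzero_abs_ge1 unfolding int_vec_def by blast
  then show ?thesis using component_le_norm_cart[of v i] by linarith
qed

text \<open>Take \<open>v\<close> to be \<open>E\<close> times the inverse of the rational
  approximant \<open>q\<close> of \<open>z\<close>, applied to the basis vector of axis
  \<open>a\<close>. It is integral because \<open>E\<close> clears denominators, and
  \<open>q\<close> sends it into the contracted axis. The first term of the bound comes from this
  contracted part; the second is the error \<open>z - q\<close>, which the boost stretches by at
  most \<open>2 ^ T\<close>.\<close>

lemma short_vector:
  fixes y z :: "real ^ 'n ^ 'n::finite"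
  assumes y: "mbound y (M ^ j)" and z: "near_rat z (M ^ k) (real k * \<eta> * M ^ k)"
    and M: "1 \<le> M" and \<eta>: "0 \<le> \<eta>" and n: "j + k \<le> n"
  shows "\<exists>v. int_vec v \<and> v \<noteq> 0 \<and>
    norm (y ** boost a b (2 ^ T) ** z *v v) \<le> M ^ (2 * n) / 2 ^ T + 2 ^ T * real n * \<eta> * M ^ (4 * n)"
proof -
  obtain q where q: "height_le q (M ^ k)" "mbound (z - q) (real k * \<eta> * M ^ k)"
    using z unfolding near_rat_def by blast
  obtain q' E where E: "is_inverse q q'" "0 < E" "real E \<le> M ^ k"
    "integral_mat (real E *\<^sub>R q')" "mbound q' (M ^ k)"
    using q(1) unfolding height_le_def by blast
  define e :: "real ^ 'n" where "e = axis a 1"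
  define v where "v = (real E *\<^sub>R q') *v e"
  define w where "w = (z - q) *v v"
  have v: "v = real E *\<^sub>R (q' *v e)" by (simp add: v_def scaleR_matrix_vector_assoc)
  have qv: "q *v v = real E *\<^sub>R e"
    using E(1) by (simp add: v is_inverse_def matrix_vector_mult_scaleR matrix_vector_mul_assoc)
  have nv: "norm v \<le> M ^ k * M ^ k"
  proof -
    have "norm v = real E * norm (q' *v e)" by (simp add: v)
    also have "\<dots> \<le> M ^ k * (M ^ k * norm e)"
      using E(3) mboundD[OF E(5)] M by (intro mult_mono) auto
    finally show ?thesis by (simp add: e_def)
  qed
  have nw: "norm w \<le> real k * \<eta> * M ^ k * (M ^ k * M ^ k)"
    unfolding w_def
    by (rule order_trans[OF mboundD[OF q(2)] mult_left_mono[OF nv]]) (use \<eta> M in simp)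
  let ?B = "boost a b (2 ^ T)"
  have "?B *v (z *v v) = (real E / 2 ^ T) *\<^sub>R e + ?B *v w"
  proof -
    have "z *v v = q *v v + w" by (simp add: w_def matrix_vector_mult_diff_rdistrib)
    then show ?thesis
      by (simp add: qv matrix_vector_right_distrib matrix_vector_mult_scaleR e_def boost_contracts)
  qed
  then have "norm (?B *v (z *v v)) \<le> norm ((real E / 2 ^ T) *\<^sub>R e) + norm (?B *v w)"
    by (simp only: norm_triangle_ineq)
  also have "\<dots> \<le> M ^ k / 2 ^ T + 2 ^ T * (real k * \<eta> * M ^ k * (M ^ k * M ^ k))"
  proof (rule add_mono)
    show "norm ((real E / 2 ^ T) *\<^sub>R e) \<le> M ^ k / 2 ^ T"
      using E(3) by (simp add: e_def divide_right_mono)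
    have "norm (?B *v w) \<le> 2 ^ T * norm w" by (intro mboundD mbound_boost) simp
    then show "norm (?B *v w) \<le> 2 ^ T * (real k * \<eta> * M ^ k * (M ^ k * M ^ k))"
      using mult_left_mono[OF nw, of "2 ^ T"] by (rule order_trans) simp
  qed
  finally have *: "norm (?B *v (z *v v)) \<le> M ^ k / 2 ^ T + 2 ^ T * (real k * \<eta> * M ^ k * (M ^ k * M ^ k))" .
  have "norm (y *v (?B *v (z *v v)))
      \<le> M ^ j * (M ^ k / 2 ^ T + 2 ^ T * (real k * \<eta> * M ^ k * (M ^ k * M ^ k)))"
    by (rule order_trans[OF mboundD[OF y] mult_left_mono[OF *]]) (use M in simp)
  also have "\<dots> = M ^ (j + k) / 2 ^ T + 2 ^ T * (real k * \<eta>) * M ^ (j + 3 * k)"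
    by (simp add: power_add power_mult power3_eq_cube field_simps)
  \<comment> \<open>The exponents \<open>j + k\<close> and \<open>j + 3 * k\<close> are at most
    \<open>n\<close> and \<open>3 * n\<close>; they are rounded up generously.\<close>
  also have "\<dots> \<le> M ^ (2 * n) / 2 ^ T + 2 ^ T * (real n * \<eta>) * M ^ (4 * n)"
    using n M \<eta>
    by (intro add_mono divide_right_mono mult_mono power_increasing mult_nonneg_nonneg) auto
  finally have "norm (y ** ?B ** z *v v) \<le> M ^ (2 * n) / 2 ^ T + 2 ^ T * real n * \<eta> * M ^ (4 * n)"
    by (simp add: mult.assoc flip: matrix_vector_mul_assoc)
  moreover have "int_vec v" unfolding v_def
    by (rule int_vec_mult[OF E(4)]) (simp add: int_vec_def e_def axis_def)
  moreover have "v \<noteq> 0"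
    using qv E(2) by (auto simp: e_def axis_eq_0_iff)
  ultimately show ?thesis by blast
qed

section \<open>Lattices without short vectors and compact sets\<close>

definition no_short :: "real \<Rightarrow> (real ^ 'n ^ 'n::finite) set"
  where "no_short c = {g \<in> SL. \<forall>v. int_vec v \<and> v \<noteq> 0 \<longrightarrow> c \<le> norm (g *v v)}"

lemma closed_no_short: "\<exists>S. closed S \<and> no_short c = (SL :: (real ^ 'n ^ 'n::finite) set) \<inter> S"
proof (intro exI conjI)
  let ?S = "\<Inter>v\<in>{v. int_vec v \<and> v \<noteq> 0}. {g :: real^'n^'n. c \<le> norm (g *v v)}"
  show "no_short c = SL \<inter> ?S" by (auto simp: no_short_def)
  have "continuous_on UNIV (\<lambda>g :: real^'n^'n. norm (g *v v))" for v
    unfolding matrix_vector_mult_def by (intro continuous_intros)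
  then have "closed {g :: real^'n^'n. c \<le> norm (g *v v)}" for v
    by (intro closed_Collect_le continuous_on_const)
  then show "closed ?S" by auto
qed

lemma no_short_sets [measurable]: "no_short c \<in> sets (SL_borel :: (real ^ 'n ^ 'n::finite) measure)"
proof -
  obtain S where S: "closed S" "no_short c = (SL :: (real ^ 'n ^ 'n) set) \<inter> S" using closed_no_short by blast
  then show ?thesis unfolding SL_borel_def sets_restrict_space S(2) by (intro imageI borel_closed)
qed

lemma SL_mat_1: "mat 1 \<in> SL"
  by (simp add: SL_def)

lemma SL_coset_eqD:
  assumes "SL_coset g = SL_coset h" shows "\<exists>\<gamma>\<in>SL_int. h = g ** \<gamma>"
proof -
  have "mat 1 \<in> SL_int" by (simp add: SL_int_def SL_mat_1) (simp add: mat_def)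
  then have "h \<in> SL_coset h" unfolding SL_coset_def by (metis image_eqI matrix_mul_rid)
  with assms show ?thesis unfolding SL_coset_def by auto
qed

text \<open>The easy half of Mahler's compactness criterion. The lattices with shortest vector
  longer than \<open>1 / (m + 1)\<close> form open sets, invariant under \<open>SL_int\<close>, that
  increase with \<open>m\<close> and exhaust \<open>SL\<close>. Their images are an open cover of
  \<open>K\<close>, and a finite subcover gives one bound.\<close>

lemma compact_no_short:
  fixes K :: "(real ^ 'n ^ 'n::finite) set set"
  assumes "compactin SL_quotient K"
  shows "\<exists>c>0. coset_preimage K \<subseteq> no_short c"
proof -
  \<comment> \<open>The strict inequality leaves the room that makes \<open>W m\<close>
    open.\<close>
  define W :: "nat \<Rightarrow> (real^'n^'n) set" where "W m = {g \<in> SL. \<exists>c>inverse (Suc m). g \<in> no_short c}" for m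
  have W_open: "openin SL_top (W m)" for m
    unfolding openin_euclidean_subtopology_iff
  proof (intro conjI ballI)
    show "W m \<subseteq> SL" by (auto simp: W_def)
    fix g assume "g \<in> W m"
    then obtain c where g: "g \<in> SL" and c: "c > inverse (Suc m)" "g \<in> no_short c" by (auto simp: W_def)
    define C where "C = real CARD('n) * real CARD('n)"
    obtain B where B: "mbound (matrix_inv g) B" using mbound_onorm by blast
    have B0: "0 \<le> B" using mbound_nonneg[OF B] .
    have C0: "0 \<le> C" by (simp add: C_def)
    \<comment> \<open>A perturbation of \<open>g\<close> of size \<open>e\<close> changes
      \<open>g *v v\<close> by at most \<open>C * e * norm v\<close>, and \<open>norm v\<close> is
      at most \<open>B * norm (g *v v)\<close>. So the lower bound \<open>c\<close> shrinks by the
      factor \<open>1 - C * e * B\<close>, which tends to one with \<open>e\<close>.\<close>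
    have "\<exists>e>0. inverse (Suc m) < c * (1 - C * e * B)"
    proof -
      have "((\<lambda>e. c * (1 - C * e * B)) \<longlongrightarrow> c * (1 - C * 0 * B)) (at_right 0)"
        by (intro tendsto_intros)
      then have "eventually (\<lambda>e. inverse (Suc m) < c * (1 - C * e * B)) (at_right 0)"
        using c(1) by (intro order_tendstoD(1)) auto
      moreover have "eventually (\<lambda>e. e > (0::real)) (at_right 0)" by (rule eventually_at_right_less)
      ultimately have "eventually (\<lambda>e. 0 < e \<and> inverse (Suc m) < c * (1 - C * e * B)) (at_right 0)"
        by eventually_elim simp
      then show ?thesis using eventually_happens' trivial_limit_at_right_real by blast
    qed
    then obtain e where e: "0 < e" "inverse (Suc m) < c * (1 - C * e * B)" by blast
    have "h \<in> W m" if h: "h \<in> SL" "dist h g < e" for h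
    proof -
      have hg: "mbound (h - g) (C * e)"
        using mbound_mono[OF mbound_norm[of "h - g"]] h(2) unfolding C_def
        by (simp add: dist_norm mult_left_mono)
      have "c * (1 - C * e * B) \<le> norm (h *v v)" if v: "int_vec v" "v \<noteq> 0" for v
      proof -
        have "norm v = norm (matrix_inv g *v (g *v v))"
          using SL_is_inverse[OF g] by (simp add: is_inverse_def matrix_vector_mul_assoc)
        also have "\<dots> \<le> B * norm (g *v v)" by (rule mboundD[OF B])
        finally have "C * e * norm v \<le> C * e * (B * norm (g *v v))"
          using C0 e(1) by (intro mult_left_mono) auto
        moreover have "norm (g *v v) - norm ((h - g) *v v) \<le> norm (h *v v)"
          using norm_triangle_ineq4[of "h *v v" "(h - g) *v v"] by (simp add: matrix_vector_mult_diff_rdistrib)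
        ultimately have "norm (g *v v) * (1 - C * e * B) \<le> norm (h *v v)"
          using mboundD[OF hg, of v] by (simp add: algebra_simps)
        moreover have "c * (1 - C * e * B) \<le> norm (g *v v) * (1 - C * e * B)"
        proof (rule mult_right_mono)
          show "c \<le> norm (g *v v)" using c(2) v by (auto simp: no_short_def)
          have "0 < c" using c(1) by (auto intro: less_trans[rotated])
          moreover have "0 < c * (1 - C * e * B)" using e(2) by (auto intro: less_trans[rotated])
          ultimately show "0 \<le> 1 - C * e * B" by (simp add: zero_less_mult_iff)
        qed
        ultimately show ?thesis by linarith
      qed
      then have "h \<in> no_short (c * (1 - C * e * B))" using h(1) by (auto simp: no_short_def)
      then show ?thesis unfolding W_def using h(1) e(2) by blast
    qed
    then show "\<exists>e>0. \<forall>h\<in>SL. dist h g < e \<longrightarrow> h \<in> W m" using e(1) by blast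
  qed
  \<comment> \<open>Elements of \<open>SL_int\<close> map nonzero integer vectors to nonzero integer
    vectors, so \<open>W m\<close> is a union of cosets.\<close>
  have W_inv: "h \<in> W m" if h: "h \<in> SL" "g \<in> W m" "SL_coset h = SL_coset g" for g h m
  proof -
    obtain c where g: "g \<in> SL" and c: "c > inverse (Suc m)" "g \<in> no_short c" using h(2) by (auto simp: W_def)
    obtain \<gamma> where \<gamma>: "\<gamma> \<in> SL_int" "h = g ** \<gamma>" using SL_coset_eqD[of g h] h(3) by auto
    have "c \<le> norm (h *v v)" if v: "int_vec v" "v \<noteq> 0" for v
    proof -
      have "int_vec (\<gamma> *v v)" using \<gamma>(1) v(1) by (intro int_vec_mult) (auto simp: SL_int_def integral_mat_def)
      moreover have "\<gamma> *v v \<noteq> 0"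
      proof
        assume "\<gamma> *v v = 0"
        then have "matrix_inv \<gamma> *v (\<gamma> *v v) = 0" by simp
        then show False
          using SL_is_inverse[of \<gamma>] \<gamma>(1) v(2) by (simp add: SL_int_def is_inverse_def matrix_vector_mul_assoc)
      qed
      ultimately have "c \<le> norm (g *v (\<gamma> *v v))" using c(2) by (auto simp: no_short_def)
      then show ?thesis by (simp add: \<gamma>(2) matrix_vector_mul_assoc)
    qed
    then show ?thesis using h(1) c(1) by (auto simp: W_def no_short_def)
  qed
  have W_mono: "W m \<subseteq> W k" if "m \<le> k" for m k
  proof -
    have "inverse (real (Suc k)) \<le> inverse (real (Suc m))" using that by (simp add: field_simps)
    then show ?thesis unfolding W_def using le_less_trans by blast
  qed
  \<comment> \<open>A nonzero integer vector has norm at least one, so \<open>g\<close> shrinks it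
    at most by the norm of its inverse.\<close>
  have W_cover: "\<exists>m. g \<in> W m" if g: "g \<in> SL" for g
  proof -
    obtain B0 where B0: "mbound (matrix_inv g) B0" using mbound_onorm by blast
    define B where "B = max B0 1"
    have B: "mbound (matrix_inv g) B" using mbound_mono[OF B0] by (simp add: B_def)
    have "0 < B" by (simp add: B_def)
    have "1 / B \<le> norm (g *v v)" if v: "int_vec v" "v \<noteq> 0" for v
    proof -
      have "1 \<le> norm v" by (rule int_vec_norm_ge1[OF v])
      also have "norm v = norm (matrix_inv g *v (g *v v))"
        using SL_is_inverse[OF g] by (simp add: is_inverse_def matrix_vector_mul_assoc)
      also have "\<dots> \<le> B * norm (g *v v)" by (rule mboundD[OF B])
      finally show ?thesis using \<open>0 < B\<close> by (simp add: field_simps)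
    qed
    moreover obtain m where "inverse (Suc m) < 1 / B" using reals_Archimedean[of "1 / B"] \<open>0 < B\<close> by auto
    ultimately show ?thesis using g by (auto simp: W_def no_short_def)
  qed
  define U where "U m = SL_coset ` W m" for m
  have pre: "{g \<in> SL. SL_coset g \<in> U m} = W m" for m
  proof (intro subset_antisym subsetI)
    fix g assume "g \<in> {g \<in> SL. SL_coset g \<in> U m}"
    then obtain h where "g \<in> SL" "h \<in> W m" "SL_coset g = SL_coset h" unfolding U_def by blast
    then show "g \<in> W m" by (rule W_inv)
  next
    fix g assume "g \<in> W m"
    then show "g \<in> {g \<in> SL. SL_coset g \<in> U m}" unfolding U_def W_def by blast
  qed
  have "openin SL_quotient (U m)" for m
    unfolding openin_SL_quotient pre using W_open[of m] unfolding U_def W_def by blast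
  moreover have "K \<subseteq> \<Union>(range U)"
  proof
    fix x assume "x \<in> K"
    then have "x \<in> topspace SL_quotient" using assms by (auto simp: compactin_def)
    then obtain g where "g \<in> SL" "x = SL_coset g"
      using openin_SL_quotient[of "topspace SL_quotient"] by auto
    then show "x \<in> \<Union>(range U)" using W_cover[of g] by (auto simp: U_def)
  qed
  ultimately obtain F where F: "finite F" "F \<subseteq> range U" "K \<subseteq> \<Union>F"
    using assms unfolding compactin_def by (metis (no_types, lifting) image_iff)
  obtain I where I: "finite I" "F = U ` I" using F(1,2) by (meson finite_subset_image)
  obtain k where k: "\<forall>m\<in>I. m \<le> k" using I(1) finite_nat_set_iff_bounded_le by blast
  have "coset_preimage K \<subseteq> W k"
  proof
    fix g assume g: "g \<in> coset_preimage K"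
    then obtain m where m: "m \<in> I" "SL_coset g \<in> U m" using F(3) I(2) by (auto simp: coset_preimage_def)
    then have "g \<in> W m" using pre[of m] g by (auto simp: coset_preimage_def)
    with W_mono[of m k] k m(1) show "g \<in> W k" by auto
  qed
  also have "W k \<subseteq> no_short (inverse (Suc k))"
    unfolding W_def no_short_def by (auto intro: order_trans less_imp_le)
  finally show ?thesis by (intro exI[of _ "inverse (real (Suc k))"]) simp
qed

text \<open>On \<open>SL\<close> Cramer's rule makes the inverse polynomial in the entries; this
  yields both its continuity and its rationality on rational matrices.\<close>

lemma matrix_inv_cramer:
  assumes "A \<in> SL"
  shows "matrix_inv A $ k $ j = det (\<chi> i l. if l = k then axis j 1 $ i else A $ i $ l)"
proof -
  have "A *v (matrix_inv A *v axis j 1) = axis j 1"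
    using SL_is_inverse[OF assms] by (simp add: is_inverse_def matrix_vector_mul_assoc)
  then have "matrix_inv A *v axis j 1 = (\<chi> k. det (\<chi> i l. if l = k then axis j 1 $ i else A $ i $ l) / det A)"
    using assms by (subst (asm) cramer) (auto simp: SL_def)
  moreover have "(matrix_inv A *v axis j 1) $ k = matrix_inv A $ k $ j"
    by (simp add: matrix_vector_mul_component inner_axis)
  ultimately show ?thesis using assms by (simp add: SL_def)
qed

lemma continuous_on_det:
  fixes f :: "'a::topological_space \<Rightarrow> real ^ 'n ^ 'n::finite"
  assumes "\<And>i j. continuous_on S (\<lambda>x. f x $ i $ j)"
  shows "continuous_on S (\<lambda>x. det (f x))"
  unfolding det_def by (intro continuous_intros assms)

lemma continuous_on_matrix_inv: "continuous_on SL (matrix_inv :: real^'n^'n::finite \<Rightarrow> _)"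
proof -
  have "continuous_on SL (\<lambda>A :: real^'n^'n. \<chi> k j. det (\<chi> i l. if l = k then axis j 1 $ i else A $ i $ l))"
    apply (intro continuous_on_vec_lambda continuous_on_det)
    subgoal for k j i l
      by (cases "l = k") (auto intro!: continuous_intros)
    done
  moreover have "matrix_inv A = (\<chi> k j. det (\<chi> i l. if l = k then axis j 1 $ i else A $ i $ l))"
    if "A \<in> SL" for A :: "real^'n^'n"
    using matrix_inv_cramer[OF that] by (simp add: vec_eq_iff)
  ultimately show ?thesis by (simp cong: continuous_on_cong)
qed

lemma measurable_matrix_inv: "matrix_inv \<in> SL_borel \<rightarrow>\<^sub>M (SL_borel :: (real^'n^'n::finite) measure)"
proof -
  have "matrix_inv \<in> SL_borel \<rightarrow>\<^sub>M (borel :: (real^'n^'n) measure)"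
    unfolding SL_borel_def by (intro borel_measurable_continuous_on_restrict continuous_on_matrix_inv)
  then show ?thesis
    unfolding SL_borel_def[where 'n='n]
    by (intro measurable_restrict_space2) (auto simp: matrix_inv_SL simp flip: SL_borel_def)
qed

section \<open>Density of rational matrices in \<open>SL\<close>\<close>

definition rational_mat :: "real ^ 'n ^ 'n::finite \<Rightarrow> bool"
  where "rational_mat A \<longleftrightarrow> (\<forall>i j. A $ i $ j \<in> \<rat>)"

lemma rational_det: "rational_mat A \<Longrightarrow> det A \<in> \<rat>"
  unfolding det_def rational_mat_def by (intro Rats_sum Rats_mult Rats_prod) auto

lemma rational_matrix_inv:
  assumes "A \<in> SL" "rational_mat A" shows "rational_mat (matrix_inv A)"
proof -
  have "rational_mat (\<chi> i l. if l = k then axis j 1 $ i else A $ i $ l)" for k j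
    using assms(2) by (simp add: rational_mat_def axis_def)
  then show ?thesis
    unfolding rational_mat_def[of "matrix_inv A"] matrix_inv_cramer[OF assms(1)] using rational_det by blast
qed

lemma common_denominator:
  assumes "finite S" "S \<subseteq> \<rat>"
  shows "\<exists>E::nat. 0 < E \<and> (\<forall>x\<in>S. real E * x \<in> \<int>)"
  using assms
proof (induction S rule: finite_induct)
  case empty
  then show ?case by (intro exI[of _ 1]) simp
next
  case (insert x S)
  then obtain E :: nat where E: "0 < E" "\<forall>x\<in>S. real E * x \<in> \<int>" by auto
  have "x \<in> \<rat>" using insert.prems by simp
  then obtain p :: int and q :: nat where pq: "q \<noteq> 0" "x = real_of_int p / real q"
    unfolding Rats_eq_int_div_nat by blast
  have qx: "real q * x \<in> \<int>" using pq by simp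
  have "real (E * q) * y \<in> \<int>" if "y \<in> insert x S" for y
  proof (cases "y = x")
    case True
    then have "real (E * q) * y = real E * (real q * x)" by simp
    also have "\<dots> \<in> \<int>" by (rule Ints_mult[OF Ints_of_nat qx])
    finally show ?thesis .
  next
    case False
    then have "real (E * q) * y = real q * (real E * y)" by simp
    also have "\<dots> \<in> \<int>" by (rule Ints_mult[OF Ints_of_nat]) (use E(2) that False in blast)
    finally show ?thesis .
  qed
  with E(1) pq(1) show ?case by (intro exI[of _ "E * q"]) auto
qed

lemma rational_height:
  assumes "A \<in> SL" "rational_mat A"
  shows "\<exists>H::nat. height_le A (2 ^ H)"
proof -
  let ?A' = "matrix_inv A"
  define S where "S = (\<Union>i j. {A $ i $ j, ?A' $ i $ j})"
  have "finite S" by (auto simp: S_def)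
  moreover have "S \<subseteq> \<rat>"
    using assms(2) rational_matrix_inv[OF assms] by (auto simp: S_def rational_mat_def)
  ultimately obtain E :: nat where E: "0 < E" "\<forall>x\<in>S. real E * x \<in> \<int>" using common_denominator by blast
  obtain b c where bc: "mbound A b" "mbound ?A' c" using mbound_onorm by blast
  obtain H :: nat where "max (real E) (max b c) < 2 ^ H"
    using real_arch_pow[of 2 "max (real E) (max b c)"] by auto
  then have "real E \<le> 2 ^ H" "mbound A (2 ^ H)" "mbound ?A' (2 ^ H)"
    using bc by (auto intro: mbound_mono)
  moreover have "integral_mat (real E *\<^sub>R A)" "integral_mat (real E *\<^sub>R ?A')"
    using E(2) by (auto simp: integral_mat_def S_def)
  ultimately show ?thesis
    unfolding height_le_def using SL_is_inverse[OF assms(1)] E(1) by blast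
qed

text \<open>Every ball contains a box around its centre with rational corners, and the midpoint of
  such a box is rational.\<close>

lemma rational_mat_dense:
  fixes U :: "(real ^ 'n ^ 'n::finite) set"
  assumes "open U" "g \<in> U"
  shows "\<exists>h\<in>U. rational_mat h"
proof -
  obtain e where e: "e > 0" "ball g e \<subseteq> U" using assms openE by blast
  obtain l u where lu: "\<forall>i\<in>Basis. l \<bullet> i \<in> \<rat> \<and> u \<bullet> i \<in> \<rat>" "g \<in> box l u" "box l u \<subseteq> ball g e"
    using rational_boxes[OF e(1)] by blast
  define h where "h = (1/2) *\<^sub>R (l + u)"
  have "h \<in> box l u"
    using lu(2) by (fastforce simp: box_def h_def inner_add_left)
  moreover have "h $ i $ j \<in> \<rat>" for i j
  proof -
    have B: "axis i (axis j 1) \<in> (Basis :: (real^'n^'n) set)" by (auto simp: Basis_vec_def)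
    have "h $ i $ j = (1/2) * (l \<bullet> axis i (axis j 1) + u \<bullet> axis i (axis j 1))"
      by (simp add: h_def inner_axis)
    moreover have "\<dots> \<in> \<rat>" using lu(1) B by (intro Rats_mult Rats_add) auto
    ultimately show ?thesis by (simp only:)
  qed
  ultimately show ?thesis using lu(3) e(2) unfolding rational_mat_def by blast
qed

text \<open>A rational matrix close to \<open>SL\<close> is moved into \<open>SL\<close> by dividing one row by its determinant.\<close>

lemma rational_SL_dense:
  fixes U :: "(real ^ 'n ^ 'n::finite) set"
  assumes "open U" "g \<in> U" "g \<in> SL"
  shows "\<exists>h\<in>U. h \<in> SL \<and> rational_mat h"
proof -
  define k :: 'n where "k = undefined"
  define D where "D = {h :: real^'n^'n. det h \<noteq> 0}"
  define \<Phi> :: "real^'n^'n \<Rightarrow> real^'n^'n"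
    where "\<Phi> h = (\<chi> i j. if i = k then (1 / det h) * h $ i $ j else h $ i $ j)" for h
  have cd: "continuous_on S (\<lambda>h :: real^'n^'n. det h)" for S
    by (intro continuous_on_det continuous_intros)
  have "D = (\<lambda>h. det h) -` (- {0})" by (auto simp: D_def)
  moreover have "open \<dots>" by (rule open_vimage[OF _ cd]) (rule open_Compl, simp)
  ultimately have D: "open D" by (simp only:)
  have "continuous_on D \<Phi>"
    unfolding \<Phi>_def
    apply (intro continuous_on_vec_lambda)
    subgoal for i j
      by (cases "i = k") (auto intro!: continuous_intros cd simp: D_def)
    done
  \<comment> \<open>Since \<open>\<Phi>\<close> fixes \<open>g\<close>, this is an open
    neighbourhood of \<open>g\<close>, and \<open>\<Phi>\<close> sends any rational matrix in it to
    a rational matrix in \<open>U\<close> and \<open>SL\<close>.\<close>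
  then have op: "open (\<Phi> -` U \<inter> D)" using D assms(1) by (simp add: continuous_on_open_vimage)
  have "\<Phi> g = g" using assms(3) by (simp add: \<Phi>_def vec_eq_iff SL_def)
  then have "g \<in> \<Phi> -` U \<inter> D" using assms(2,3) by (simp add: D_def SL_def)
  then obtain h where h: "h \<in> \<Phi> -` U \<inter> D" "rational_mat h" using rational_mat_dense[OF op] by blast
  have "\<Phi> h = (\<chi> i. if i = k then (1 / det h) *s (h $ i) else h $ i)"
    by (simp add: \<Phi>_def vec_eq_iff)
  then have "det (\<Phi> h) = (1 / det h) * det (\<chi> i. if i = k then h $ i else h $ i)"
    by (simp only: det_row_mul)
  then have "\<Phi> h \<in> SL" using h(1) by (simp add: SL_def D_def)
  moreover have "rational_mat (\<Phi> h)"
    using h(2) rational_det[OF h(2)] by (auto simp: rational_mat_def \<Phi>_def)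
  ultimately show ?thesis using h(1) by blast
qed

text \<open>Separability is applied to the set of rational points of \<open>SL\<close> itself, so
  the countable dense subset consists of such points; it is then enumerated.\<close>

lemma dense_rational_sequence:
  "\<exists>r :: nat \<Rightarrow> real ^ 'n ^ 'n::finite. (\<forall>l. r l \<in> SL \<and> rational_mat (r l)) \<and>
    (\<forall>U. open U \<and> U \<inter> SL \<noteq> {} \<longrightarrow> (\<exists>l. r l \<in> U))"
proof -
  obtain T :: "(real^'n^'n) set" where T: "countable T" "T \<subseteq> {h \<in> SL. rational_mat h}"
      "{h \<in> SL. rational_mat h} \<subseteq> closure T"
    using separable by blast
  have ne: "T \<noteq> {}"
    using T(3) SL_mat_1 rational_SL_dense[of UNIV "mat 1"] by fastforce
  have "\<exists>l. from_nat_into T l \<in> U" if U: "open U" "U \<inter> SL \<noteq> {}" for U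
  proof -
    obtain h where "h \<in> U" "h \<in> SL" "rational_mat h" using rational_SL_dense U by blast
    then have "h \<in> closure T \<inter> U" using T(3) by blast
    then have "T \<inter> U \<noteq> {}" using open_Int_closure_eq_empty[OF U(1), of T] by blast
    then obtain t where "t \<in> T" "t \<in> U" by blast
    then show ?thesis using from_nat_into_surj[OF T(1)] by metis
  qed
  moreover have "from_nat_into T l \<in> T" for l using from_nat_into[OF ne] .
  ultimately show ?thesis using T(2) by (intro exI[of _ "from_nat_into T"]) blast
qed

section \<open>Convolution powers\<close>

text \<open>The Markov operator of the random walk that multiplies by independent steps on the
  right.\<close>

definition avg :: "(real ^ 'n ^ 'n::finite) measure \<Rightarrow> (real ^ 'n ^ 'n \<Rightarrow> ennreal) \<Rightarrow> real ^ 'n ^ 'n \<Rightarrow> ennreal"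
  where "avg \<mu> f x = (\<integral>\<^sup>+ h. f (x ** h) \<partial>\<mu>)"

lemma measurable_mult_SL:
  fixes f :: "real ^ 'n ^ 'n::finite \<Rightarrow> ennreal"
  assumes "f \<in> borel_measurable SL_borel"
  shows "(\<lambda>(g, h). f (g ** h)) \<in> borel_measurable (SL_borel \<Otimes>\<^sub>M SL_borel)"
  using measurable_compose[OF measurable_SL_mult assms] by (simp add: case_prod_unfold)

lemma measurable_left_mult_SL:
  fixes f :: "real ^ 'n ^ 'n::finite \<Rightarrow> ennreal"
  assumes "f \<in> borel_measurable SL_borel" "x \<in> SL"
  shows "(\<lambda>h. f (x ** h)) \<in> borel_measurable SL_borel"
  using measurable_Pair2[OF measurable_mult_SL[OF assms(1)], of x] assms(2) by simp

lemma measurable_avg: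
  assumes \<mu>: "SL_prob \<mu>" and f: "f \<in> borel_measurable SL_borel"
  shows "avg \<mu> f \<in> borel_measurable SL_borel"
proof -
  interpret prob_space \<mu> using \<mu> by (simp add: SL_prob_def)
  have s: "sets (SL_borel \<Otimes>\<^sub>M \<mu>) = sets (SL_borel \<Otimes>\<^sub>M SL_borel)"
    using \<mu> by (intro sets_pair_measure_cong) (auto simp: SL_prob_def)
  have "(\<lambda>(g, h). f (g ** h)) \<in> borel_measurable (SL_borel \<Otimes>\<^sub>M \<mu>)"
    using measurable_mult_SL[OF f] measurable_cong_sets[OF s refl] by blast
  then show ?thesis unfolding avg_def[abs_def] by (rule borel_measurable_nn_integral)
qed

lemma nn_integral_SL_conv:
  assumes \<mu>: "SL_prob \<mu>" and \<nu>: "SL_prob \<nu>" and f: "f \<in> borel_measurable SL_borel"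
  shows "(\<integral>\<^sup>+ x. f x \<partial>SL_conv \<mu> \<nu>) = (\<integral>\<^sup>+ g. avg \<nu> f g \<partial>\<mu>)"
proof -
  interpret prob_space \<nu> using \<nu> by (simp add: SL_prob_def)
  have s: "sets (\<mu> \<Otimes>\<^sub>M \<nu>) = sets (SL_borel \<Otimes>\<^sub>M SL_borel)"
    using \<mu> \<nu> by (intro sets_pair_measure_cong) (auto simp: SL_prob_def)
  have m: "(\<lambda>(g, h). g ** h) \<in> \<mu> \<Otimes>\<^sub>M \<nu> \<rightarrow>\<^sub>M SL_borel"
    using measurable_SL_mult measurable_cong_sets[OF s refl] by blast
  have m2: "(\<lambda>(g, h). f (g ** h)) \<in> borel_measurable (\<mu> \<Otimes>\<^sub>M \<nu>)"
    using measurable_mult_SL[OF f] measurable_cong_sets[OF s refl] by blast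
  show ?thesis
    unfolding SL_conv_def avg_def
    by (subst nn_integral_distr[OF m]) (use f nn_integral_fst[OF m2] in \<open>simp_all add: case_prod_unfold\<close>)
qed

text \<open>Turns statements about the law after \<open>k\<close> steps into statements about
  iterates of the Markov operator, which can be bounded by induction on the number of remaining
  steps.\<close>

lemma nn_integral_SL_conv_power:
  assumes \<mu>: "SL_prob \<mu>" and f: "f \<in> borel_measurable SL_borel"
  shows "(\<integral>\<^sup>+ x. f x \<partial>SL_conv_power \<mu> k) = (avg \<mu> ^^ k) f (mat 1)"
  using f
proof (induction k arbitrary: f)
  case 0
  then show ?case by (simp add: nn_integral_return SL_mat_1)
next
  case (Suc k)
  have "(\<integral>\<^sup>+ x. f x \<partial>SL_conv_power \<mu> (Suc k)) = (\<integral>\<^sup>+ x. avg \<mu> f x \<partial>SL_conv_power \<mu> k)"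
    using nn_integral_SL_conv[OF SL_prob_conv_power[OF \<mu>] \<mu> Suc.prems] by simp
  also have "\<dots> = (avg \<mu> ^^ k) (avg \<mu> f) (mat 1)"
    by (rule Suc.IH[OF measurable_avg[OF \<mu> Suc.prems]])
  finally show ?case by (simp add: funpow_swap1)
qed

text \<open>
  Here \<open>P j x\<close> should hold for products \<open>x\<close> of \<open>j\<close> steps from \<open>L\<close>, and \<open>Q j x\<close> for products of
  \<open>j\<close> steps one of which is in \<open>B\<close> while the others are in \<open>L\<close>; the bound is a binomial probability.
\<close>

lemma SL_conv_power_lower_bound:
  fixes X :: "'w \<Rightarrow> real ^ 'n ^ 'n::finite"
  assumes "prob_space \<Omega>" and X: "X \<in> \<Omega> \<rightarrow>\<^sub>M SL_borel" and L: "L \<in> sets \<Omega>" and B: "B \<in> sets \<Omega>"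
    and disj: "L \<inter> B = {}" and C: "C \<in> sets SL_borel"
    and P0: "P 0 (mat 1)"
    and PL: "\<And>j x \<omega>. P j x \<Longrightarrow> \<omega> \<in> L \<Longrightarrow> P (Suc j) (x ** X \<omega>)"
    and PB: "\<And>j x \<omega>. P j x \<Longrightarrow> \<omega> \<in> B \<Longrightarrow> Q (Suc j) (x ** X \<omega>)"
    and QL: "\<And>j x \<omega>. Q j x \<Longrightarrow> \<omega> \<in> L \<Longrightarrow> Q (Suc j) (x ** X \<omega>)"
    and QC: "\<And>x. Q k x \<Longrightarrow> x \<in> SL \<Longrightarrow> x \<in> C"
  shows "of_nat k * emeasure \<Omega> B * emeasure \<Omega> L ^ (k - 1)
    \<le> emeasure (SL_conv_power (distr \<Omega> SL_borel X) k) C"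
proof -
  interpret prob_space \<Omega> by fact
  define \<mu> where "\<mu> = distr \<Omega> SL_borel X"
  define f where "f m = (avg \<mu> ^^ m) (indicator C)" for m
  have \<mu>: "SL_prob \<mu>" using prob_space_distr[OF X] by (simp add: SL_prob_def \<mu>_def)
  have f: "f m \<in> borel_measurable SL_borel" for m
    unfolding f_def using C by (induction m) (auto intro: measurable_avg[OF \<mu>])
  have X_SL: "X \<omega> \<in> SL" if "\<omega> \<in> space \<Omega>" for \<omega>
    using measurable_space[OF X that] by simp
  have sp: "\<omega> \<in> space \<Omega>" if "\<omega> \<in> L \<union> B" for \<omega>
    using that sets.sets_into_space[OF L] sets.sets_into_space[OF B] by blast
  \<comment> \<open>Condition on the next step: the integrand is bounded below on the disjoint
    events \<open>L\<close> and \<open>B\<close>, and by zero elsewhere.\<close>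
  have step: "u * emeasure \<Omega> L + v * emeasure \<Omega> B \<le> f (Suc m) x"
    if x: "x \<in> SL" and u: "\<And>\<omega>. \<omega> \<in> L \<Longrightarrow> u \<le> f m (x ** X \<omega>)" and v: "\<And>\<omega>. \<omega> \<in> B \<Longrightarrow> v \<le> f m (x ** X \<omega>)"
    for u v m x
  proof -
    have "u * emeasure \<Omega> L + v * emeasure \<Omega> B = (\<integral>\<^sup>+\<omega>. u * indicator L \<omega> + v * indicator B \<omega> \<partial>\<Omega>)"
      using L B by (simp add: nn_integral_add nn_integral_cmult)
    also have "\<dots> \<le> (\<integral>\<^sup>+\<omega>. f m (x ** X \<omega>) \<partial>\<Omega>)"
      using u v disj by (intro nn_integral_mono) (auto simp: indicator_def)
    also have "\<dots> = f (Suc m) x"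
      unfolding f_def funpow.simps comp_def avg_def[of \<mu> "(avg \<mu> ^^ m) _"]
      using nn_integral_distr[OF X, of "\<lambda>h. f m (x ** h)"] measurable_left_mult_SL[OF f[of m] x]
      by (simp add: \<mu>_def f_def)
    finally show ?thesis .
  qed
  have Q_bound: "emeasure \<Omega> L ^ m \<le> f m x" if "Q j x" "x \<in> SL" "j + m = k" for m j x
    using that
  proof (induction m arbitrary: j x)
    case 0
    then show ?case using QC[of x] by (simp add: f_def)
  next
    case (Suc m)
    have "emeasure \<Omega> L ^ m * emeasure \<Omega> L + 0 * emeasure \<Omega> B \<le> f (Suc m) x"
      using Suc.prems sp by (intro step Suc.IH[of "Suc j"] QL) (auto intro: SL_mult X_SL)
    then show ?case by (simp add: mult.commute)
  qed
  \<comment> \<open>Either the next step is the special one and all later ones lie in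
    \<open>L\<close>, or it lies in \<open>L\<close> and the special one is still to come.\<close>
  have P_bound: "of_nat m * emeasure \<Omega> B * emeasure \<Omega> L ^ (m - 1) \<le> f m x"
    if "P j x" "x \<in> SL" "j + m = k" for m j x
    using that
  proof (induction m arbitrary: j x)
    case 0
    then show ?case by simp
  next
    case (Suc m)
    have "(of_nat m * emeasure \<Omega> B * emeasure \<Omega> L ^ (m - 1)) * emeasure \<Omega> L + emeasure \<Omega> L ^ m * emeasure \<Omega> B
        \<le> f (Suc m) x"
      using Suc.prems sp
      by (intro step Suc.IH[of "Suc j"] Q_bound[of "Suc j"] PL PB) (auto intro: SL_mult X_SL)
    \<comment> \<open>The exponent \<open>m - 1\<close> is truncated at \<open>m = 0\<close>, where
      the first summand vanishes anyway.\<close>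
    also have "(of_nat m * emeasure \<Omega> B * emeasure \<Omega> L ^ (m - 1)) * emeasure \<Omega> L + emeasure \<Omega> L ^ m * emeasure \<Omega> B
        = of_nat (Suc m) * emeasure \<Omega> B * emeasure \<Omega> L ^ (Suc m - 1)"
      by (cases m) (simp_all add: algebra_simps)
    finally show ?case .
  qed
  have "emeasure (SL_conv_power \<mu> k) C = (\<integral>\<^sup>+ x. indicator C x \<partial>SL_conv_power \<mu> k)"
    using C SL_prob_conv_power[OF \<mu>, of k] by (simp add: SL_prob_def)
  also have "\<dots> = f k (mat 1)" unfolding f_def using C by (intro nn_integral_SL_conv_power[OF \<mu>]) simp
  finally show ?thesis using P_bound[OF P0 SL_mat_1, of k] by (simp add: \<mu>_def)
qed

text \<open>The triangle inequality and the entrywise bound make the operator norm Lipschitz. This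
  supplies the measurability of the moment integrand.\<close>

lemma continuous_on_onorm: "continuous_on UNIV (\<lambda>A :: real^'n^'n::finite. onorm ((*v) A))"
proof -
  have le: "onorm ((*v) A) - onorm ((*v) B) \<le> real CARD('n) * real CARD('n) * dist A B" for A B :: "real^'n^'n"
    using onorm_le_mbound[OF mbound_add[OF mbound_onorm mbound_norm[of "A - B"]], of B] by (simp add: dist_norm)
  have "(real CARD('n) * real CARD('n))-lipschitz_on UNIV (\<lambda>A :: real^'n^'n. onorm ((*v) A))"
  proof (rule lipschitz_onI)
    fix A B :: "real^'n^'n"
    show "dist (onorm ((*v) A)) (onorm ((*v) B)) \<le> real CARD('n) * real CARD('n) * dist A B"
      using le[of A B] le[of B A] by (simp add: dist_real_def dist_commute abs_le_iff)
  qed simp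
  then show ?thesis by (rule lipschitz_on_continuous_on)
qed

section \<open>Sparse binary sums\<close>

text \<open>Whole floors are used instead of binary digits because then every term is monotone in
  \<open>x\<close>. For rapidly growing \<open>e\<close> the truncations approximate the sum far
  better than their denominators suggest, as for Liouville numbers.\<close>

definition sparse_sum :: "(nat \<Rightarrow> nat) \<Rightarrow> real \<Rightarrow> real"
  where "sparse_sum e x = (\<Sum>l. of_int \<lfloor>2 ^ l * x\<rfloor> / 2 ^ e l)"

locale sparse =
  fixes e :: "nat \<Rightarrow> nat"
  assumes e_0: "0 < e 0" and e_Suc: "e l + 2 \<le> e (Suc l)"
begin

lemma e_add: "e i + 2 * m \<le> e (i + m)"
proof (induction m)
  case (Suc m)
  then show ?case using e_Suc[of "i + m"] by simp
qed simp

lemma term_nonneg: "0 < (x :: real) \<Longrightarrow> 0 \<le> real_of_int \<lfloor>2 ^ l * x\<rfloor> / 2 ^ e l"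
  by simp

text \<open>Each further index at most doubles the numerator and at least quadruples the
  denominator, so the terms decay geometrically.\<close>

lemma term_le:
  fixes x :: real
  assumes "0 < x" "x < 1"
  shows "real_of_int \<lfloor>2 ^ (l + i) * x\<rfloor> / 2 ^ e (l + i) \<le> 2 ^ i / 2 ^ e i * (1 / 2) ^ l"
proof -
  have "real_of_int \<lfloor>2 ^ (l + i) * x\<rfloor> \<le> 2 ^ (l + i)"
    using assms by (intro order_trans[OF of_int_floor_le]) simp
  moreover have "(2::real) ^ (e i + 2 * l) \<le> 2 ^ e (l + i)"
    using e_add[of i l] by (intro power_increasing) (auto simp: add.commute)
  ultimately have "real_of_int \<lfloor>2 ^ (l + i) * x\<rfloor> / 2 ^ e (l + i) \<le> 2 ^ (l + i) / 2 ^ (e i + 2 * l)"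
    by (intro frac_le) auto
  also have "\<dots> = 2 ^ i / 2 ^ e i * (1 / 2) ^ l"
    by (simp add: power_add mult_2 power_divide)
  finally show ?thesis .
qed

lemma summable_terms:
  fixes x :: real
  assumes "0 < x" "x < 1"
  shows "summable (\<lambda>l. real_of_int \<lfloor>2 ^ l * x\<rfloor> / 2 ^ e l)"
proof (rule summable_comparison_test')
  show "summable (\<lambda>l. 2 ^ 0 / 2 ^ e 0 * (1 / 2 :: real) ^ l)"
    by (intro summable_mult summable_geometric) simp
  show "norm (real_of_int \<lfloor>2 ^ l * x\<rfloor> / 2 ^ e l) \<le> 2 ^ 0 / 2 ^ e 0 * (1 / 2) ^ l" for l
    using term_le[OF assms, of l 0] term_nonneg[OF assms(1), of l] by simp
qed

lemma tail_bounds: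
  fixes x :: real
  assumes "0 < x" "x < 1"
  shows "0 \<le> (\<Sum>l. real_of_int \<lfloor>2 ^ (l + i) * x\<rfloor> / 2 ^ e (l + i))"
    and "(\<Sum>l. real_of_int \<lfloor>2 ^ (l + i) * x\<rfloor> / 2 ^ e (l + i)) \<le> 2 ^ Suc i / 2 ^ e i"
proof -
  have sm: "summable (\<lambda>l. real_of_int \<lfloor>2 ^ (l + i) * x\<rfloor> / 2 ^ e (l + i))"
    using summable_ignore_initial_segment[OF summable_terms[OF assms]] .
  then show "0 \<le> (\<Sum>l. real_of_int \<lfloor>2 ^ (l + i) * x\<rfloor> / 2 ^ e (l + i))"
    using term_nonneg[OF assms(1)] by (intro suminf_nonneg)
  have "(\<Sum>l. real_of_int \<lfloor>2 ^ (l + i) * x\<rfloor> / 2 ^ e (l + i)) \<le> (\<Sum>l. 2 ^ i / 2 ^ e i * (1 / 2) ^ l)"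
    by (intro suminf_le sm term_le[OF assms] summable_mult summable_geometric) simp
  also have "\<dots> = 2 ^ i / 2 ^ e i * (\<Sum>l. (1 / 2) ^ l)" by (intro suminf_mult summable_geometric) simp
  also have "\<dots> = 2 ^ Suc i / 2 ^ e i" by (simp add: suminf_geometric)
  finally show "(\<Sum>l. real_of_int \<lfloor>2 ^ (l + i) * x\<rfloor> / 2 ^ e (l + i)) \<le> 2 ^ Suc i / 2 ^ e i" .
qed

lemma sparse_sum_bounds:
  fixes x :: real
  assumes "0 < x" "x < 1"
  shows "0 \<le> sparse_sum e x" "sparse_sum e x \<le> 1"
proof -
  show "0 \<le> sparse_sum e x" using tail_bounds(1)[OF assms, of 0] by (simp add: sparse_sum_def)
  have "(2::real) ^ 1 \<le> 2 ^ e 0" using e_0 by (intro power_increasing) auto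
  then show "sparse_sum e x \<le> 1"
    using tail_bounds(2)[OF assms, of 0] unfolding sparse_sum_def
    by (simp add: divide_le_eq_1 del: power_increasing_iff) (erule order_trans, simp)
qed

text \<open>Cut the series after index \<open>i\<close>: the denominators kept all divide
  \<open>2 ^ e i\<close>, and the tail starting at \<open>Suc i\<close> is dominated by a geometric
  series.\<close>

lemma sparse_sum_approx:
  fixes x :: real
  assumes "0 < x" "x < 1"
  shows "\<exists>t. 2 ^ e i * t \<in> \<int> \<and> \<bar>t\<bar> \<le> 1 \<and> \<bar>sparse_sum e x - t\<bar> \<le> 2 ^ (i + 2) / 2 ^ e (Suc i)"
proof -
  define t where "t = (\<Sum>l<Suc i. real_of_int \<lfloor>2 ^ l * x\<rfloor> / 2 ^ e l)"
  have split: "sparse_sum e x = (\<Sum>l. real_of_int \<lfloor>2 ^ (l + Suc i) * x\<rfloor> / 2 ^ e (l + Suc i)) + t"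
    unfolding sparse_sum_def t_def by (rule suminf_split_initial_segment[OF summable_terms[OF assms]])
  have "0 \<le> t" unfolding t_def by (intro sum_nonneg term_nonneg assms)
  moreover have "t \<le> 1" using split tail_bounds(1)[OF assms, of "Suc i"] sparse_sum_bounds(2)[OF assms] by linarith
  moreover have "2 ^ e i * t \<in> \<int>"
  proof -
    have "2 ^ e i * (real_of_int \<lfloor>2 ^ l * x\<rfloor> / 2 ^ e l) = real_of_int (2 ^ (e i - e l) * \<lfloor>2 ^ l * x\<rfloor>)" if "l < Suc i" for l
    proof -
      have "e l \<le> e i" using e_add[of l "i - l"] that by simp
      then have "(2::real) ^ e i = 2 ^ (e i - e l) * 2 ^ e l" by (simp flip: power_add)
      then show ?thesis by simp
    qed
    then show ?thesis unfolding t_def sum_distrib_left by (intro Ints_sum) (metis Ints_of_int lessThan_iff)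
  qed
  ultimately show ?thesis
    using split tail_bounds[OF assms, of "Suc i"] by (intro exI[of _ t]) simp
qed

text \<open>No term decreases from \<open>x\<close> to \<open>y\<close>, and a term with
  \<open>2 ^ l * (y - x) > 1\<close> strictly increases. The resulting injectivity is what excludes
  atoms.\<close>

lemma sparse_sum_less:
  fixes x :: real
  assumes "0 < x" "x < y" "y < 1"
  shows "sparse_sum e x < sparse_sum e y"
proof -
  have x: "summable (\<lambda>l. real_of_int \<lfloor>2 ^ l * x\<rfloor> / 2 ^ e l)" and y: "summable (\<lambda>l. real_of_int \<lfloor>2 ^ l * y\<rfloor> / 2 ^ e l)"
    using assms by (auto intro!: summable_terms)
  obtain l :: nat where "1 / (y - x) < 2 ^ l" using real_arch_pow[of 2 "1 / (y - x)"] by auto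
  then have "2 ^ l * x + 1 < 2 ^ l * y" using assms(2) by (simp add: field_simps)
  then have "\<lfloor>2 ^ l * x\<rfloor> < \<lfloor>2 ^ l * y\<rfloor>" by linarith
  then have "0 < real_of_int \<lfloor>2 ^ l * y\<rfloor> / 2 ^ e l - real_of_int \<lfloor>2 ^ l * x\<rfloor> / 2 ^ e l"
    by (simp add: divide_strict_right_mono)
  moreover have "0 \<le> real_of_int \<lfloor>2 ^ m * y\<rfloor> / 2 ^ e m - real_of_int \<lfloor>2 ^ m * x\<rfloor> / 2 ^ e m" for m
    using assms(2) by (auto intro!: divide_right_mono floor_mono)
  ultimately have "0 < (\<Sum>m. real_of_int \<lfloor>2 ^ m * y\<rfloor> / 2 ^ e m - real_of_int \<lfloor>2 ^ m * x\<rfloor> / 2 ^ e m)"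
    by (intro suminf_pos2[OF summable_diff[OF y x]])
  then show ?thesis unfolding sparse_sum_def suminf_diff[OF y x, symmetric] by simp
qed

lemma measurable_sparse_sum [measurable]: "sparse_sum e \<in> borel_measurable borel"
  unfolding sparse_sum_def[abs_def] by measurable

end

section \<open>The heavy-tailed walk\<close>

lemma near_rat_self:
  assumes "height_le q H" shows "near_rat q H 0"
proof -
  have "mbound (q - q) 0" by (simp add: mbound_def)
  then show ?thesis unfolding near_rat_def using assms height_le_mbound by blast
qed

lemma near_rat_unip:
  assumes "a \<noteq> b" "real E * t \<in> \<int>" "\<bar>t\<bar> \<le> 1" "0 < E" "\<bar>s\<bar> \<le> 1" "\<bar>s - t\<bar> \<le> \<delta>"
  shows "near_rat (unip a b s) (2 * real E) \<delta>"
proof -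
  have "1 + \<bar>s\<bar> \<le> 2 * real E" using assms(4,5) by linarith
  then show ?thesis
    unfolding near_rat_def using height_le_unip[OF assms(1-4)]
      mbound_mono[OF mbound_unip] mbound_mono[OF unip_diff assms(6)] by blast
qed

text \<open>The last inequality is the moment condition: index \<open>l\<close> has log-norm of
  order \<open>e l ^ Suc c\<close> and probability of order \<open>1 / e l ^ c\<close>. Density is
  required along odd indices because the even ones carry the boosts.\<close>

locale heavy_walk =
  fixes a b :: "'n::finite" and r :: "nat \<Rightarrow> real ^ 'n ^ 'n" and ht :: "nat \<Rightarrow> nat"
    and c :: nat and p :: real
  assumes ab: "a \<noteq> b" and r_SL: "r l \<in> SL" and r_height: "height_le (r l) (2 ^ ht l)"
    and r_dense: "open U \<Longrightarrow> U \<inter> SL \<noteq> {} \<Longrightarrow> \<exists>l. odd l \<and> r l \<in> U"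
    and p_pos: "0 < p" and p_less: "real (Suc c) * p < real c"
begin

text \<open>The constants \<open>40\<close> here and \<open>9\<close> in \<open>T\<close> are what \<open>size_estimate\<close> requires.\<close>

primrec e :: "nat \<Rightarrow> nat" where
  "e 0 = Suc (ht 0)"
| "e (Suc l) = 40 * e l ^ Suc c + ht (Suc l)"

lemma c_pos: "0 < c"
proof (rule ccontr)
  assume "\<not> 0 < c"
  then show False using p_less p_pos by simp
qed

lemma e_pos: "0 < e l"
  by (induction l) auto

lemma e_le_power: "e l \<le> e l ^ Suc c"
  using e_pos[of l] by simp

lemma e_Suc_ge: "40 * e l ^ Suc c \<le> e (Suc l)"
  by simp

lemma ht_le: "ht l \<le> e l"
  by (cases l) auto

declare e.simps(2) [simp del]

sublocale sparse e
proof
  show "0 < e 0" by simp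
  show "e l + 2 \<le> e (Suc l)" for l
    using e_le_power[of l] e_pos[of l] e_Suc_ge[of l] by linarith
qed

lemma e_mono: "i \<le> j \<Longrightarrow> e i \<le> e j"
  using e_add[of i "j - i"] by simp

lemma e_double: "2 * e l \<le> e (Suc l)"
  using e_le_power[of l] e_Suc_ge[of l] by linarith

lemma two_pow_le_e: "2 ^ l \<le> e l"
proof (induction l)
  case (Suc l)
  then show ?case using e_double[of l] by simp
qed simp

lemma index_less_e: "l < e l"
  using two_pow_le_e[of l] less_exp[of l] by linarith

section \<open>The steps and their products\<close>

definition T :: "nat \<Rightarrow> nat" where "T l = 9 * e l ^ Suc c"

definition R :: "nat \<Rightarrow> real ^ 'n ^ 'n"
  where "R l = (if even l then boost a b (2 ^ T l) else r l)"

lemma R_SL: "R l \<in> SL"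
  using r_SL boost_SL[OF ab] by (simp add: R_def)

lemma R_height: "height_le (R l) (2 ^ T l)"
proof (cases "even l")
  case True
  then show ?thesis using height_le_boost[OF ab] by (simp add: R_def)
next
  case False
  have "ht l \<le> T l" using ht_le[of l] e_le_power[of l] unfolding T_def by linarith
  then have "(2::real) ^ ht l \<le> 2 ^ T l" by (intro power_increasing) auto
  then show ?thesis using False height_le_mono[OF r_height] by (simp add: R_def)
qed

lemma T_le_e: "l < i \<Longrightarrow> T l \<le> e i"
  using e_Suc_ge[of l] e_mono[of "Suc l" i] unfolding T_def by linarith

text \<open>The height of one step of index below \<open>i\<close>: \<open>2 ^ e i\<close> for the
  matrix \<open>R l\<close> and \<open>2 * 2 ^ e i\<close> for the truncated unipotent
  factor.\<close>

definition M :: "nat \<Rightarrow> real" where "M i = 2 ^ (2 * e i + 1)"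

text \<open>The truncation error of the sparse sum after index \<open>i\<close>, multiplied by the
  norm bound for \<open>R l\<close> or its inverse.\<close>

definition err :: "nat \<Rightarrow> real" where "err i = 2 ^ e i * (2 ^ (i + 2) / 2 ^ e (Suc i))"

lemma M_ge1: "1 \<le> M i"
  unfolding M_def by (rule one_le_power) simp

lemma err_nonneg: "0 \<le> err i"
  by (simp add: err_def)

definition X :: "(nat \<times> bool) \<times> real \<Rightarrow> real ^ 'n ^ 'n" where
  "X = (\<lambda>((l, \<sigma>), x). if \<sigma> then R l ** unip a b (sparse_sum e x)
     else unip a b (- sparse_sum e x) ** matrix_inv (R l))"

lemma X_SL: "X \<omega> \<in> SL"
  by (auto simp: X_def split_beta intro!: SL_mult R_SL unip_SL[OF ab] matrix_inv_SL)

lemma X_inverse: "is_inverse (X ((l, \<sigma>), x)) (X ((l, \<not> \<sigma>), x))"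
proof -
  have "is_inverse (R l ** unip a b (sparse_sum e x)) (unip a b (- sparse_sum e x) ** matrix_inv (R l))"
    by (intro is_inverse_mult SL_is_inverse R_SL unip_inverse ab)
  then show ?thesis using is_inverse_sym by (auto simp: X_def)
qed

lemma near_rat_unip_sum:
  assumes "0 < x" "x < 1"
  shows "near_rat (unip a b (sparse_sum e x)) (2 * 2 ^ e i) (2 ^ (i + 2) / 2 ^ e (Suc i))"
    and "near_rat (unip a b (- sparse_sum e x)) (2 * 2 ^ e i) (2 ^ (i + 2) / 2 ^ e (Suc i))"
proof -
  obtain t where t: "2 ^ e i * t \<in> \<int>" "\<bar>t\<bar> \<le> 1" "\<bar>sparse_sum e x - t\<bar> \<le> 2 ^ (i + 2) / 2 ^ e (Suc i)"
    using sparse_sum_approx[OF assms] by blast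
  have s: "\<bar>sparse_sum e x\<bar> \<le> 1" using sparse_sum_bounds[OF assms] by simp
  show "near_rat (unip a b (sparse_sum e x)) (2 * 2 ^ e i) (2 ^ (i + 2) / 2 ^ e (Suc i))"
    using near_rat_unip[OF ab, of "2 ^ e i" t "sparse_sum e x"] t s by simp
  show "near_rat (unip a b (- sparse_sum e x)) (2 * 2 ^ e i) (2 ^ (i + 2) / 2 ^ e (Suc i))"
    using near_rat_unip[OF ab, of "2 ^ e i" "- t" "- sparse_sum e x"] t s
    by (simp add: abs_minus_commute)
qed

lemma near_rat_mult_unip:
  assumes "height_le q (2 ^ e i)" "0 < x" "x < 1"
  shows "near_rat (q ** unip a b (sparse_sum e x)) (M i) (err i)"
    and "near_rat (unip a b (- sparse_sum e x) ** q) (M i) (err i)"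
proof -
  have M: "2 ^ e i * (2 * 2 ^ e i) = M i" "2 * 2 ^ e i * 2 ^ e i = M i"
    unfolding M_def mult_2[of "e i"] power_add by simp_all
  show "near_rat (q ** unip a b (sparse_sum e x)) (M i) (err i)"
    using near_rat_mult[OF near_rat_self[OF assms(1)] near_rat_unip_sum(1)[OF assms(2,3), of i]]
    unfolding M by (simp add: err_def)
  show "near_rat (unip a b (- sparse_sum e x) ** q) (M i) (err i)"
    using near_rat_mult[OF near_rat_unip_sum(2)[OF assms(2,3), of i] near_rat_self[OF assms(1)]]
    unfolding M by (simp add: err_def mult.commute)
qed

text \<open>The recursion for \<open>e\<close> makes \<open>T l \<le> e i\<close> for every smaller
  index, so even a boost of smaller index has height at most \<open>2 ^ e i\<close>.\<close>

lemma near_rat_lower_step: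
  assumes "l < i" "0 < x" "x < 1"
  shows "near_rat (X ((l, \<sigma>), x)) (M i) (err i)"
proof -
  have "(2::real) ^ T l \<le> 2 ^ e i" using T_le_e[OF assms(1)] by (intro power_increasing) auto
  then have R: "height_le (R l) (2 ^ e i)" using height_le_mono[OF R_height] by blast
  then have "height_le (matrix_inv (R l)) (2 ^ e i)"
    using height_le_inverse SL_is_inverse[OF R_SL] by blast
  with R near_rat_mult_unip[OF _ assms(2,3)] show ?thesis by (auto simp: X_def)
qed

text \<open>The unipotent factor of the big step stands to the right of its boost, so it is counted
  as a small step of the right-hand product.\<close>

lemma near_rat_unip_step:
  assumes "0 < x" "x < 1"
  shows "near_rat (unip a b (sparse_sum e x)) (M i) (err i)"
  using near_rat_mult_unip(1)[OF height_le_mono[OF height_le_id] assms, of i] by simp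

definition low :: "nat \<Rightarrow> nat \<Rightarrow> real ^ 'n ^ 'n \<Rightarrow> bool"
  where "low i j x \<longleftrightarrow> near_rat x (M i ^ j) (real j * err i * M i ^ j)"

text \<open>The boost is not counted, while the unipotent factor that comes with it is counted in
  \<open>m\<close>; hence \<open>k + m\<close> is the exact number of steps.\<close>

definition one_big :: "nat \<Rightarrow> nat \<Rightarrow> real ^ 'n ^ 'n \<Rightarrow> bool"
  where "one_big i j x \<longleftrightarrow>
    (\<exists>y z k m. k + m = j \<and> low i k y \<and> low i m z \<and> x = y ** boost a b (2 ^ T i) ** z)"

lemma low_0: "low i 0 (mat 1)"
  unfolding low_def by (rule near_rat_id)

lemma low_mult: "low i j x \<Longrightarrow> near_rat h (M i) (err i) \<Longrightarrow> low i (Suc j) (x ** h)"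
  unfolding low_def by (rule near_rat_power_mult)

lemma low_big:
  assumes "low i j x" "even i" "0 < t" "t < 1"
  shows "one_big i (Suc j) (x ** X ((i, True), t))"
proof -
  have "low i 1 (unip a b (sparse_sum e t))"
    using low_mult[OF low_0 near_rat_unip_step[OF assms(3,4), of i]] by simp
  moreover have "x ** X ((i, True), t) = x ** boost a b (2 ^ T i) ** unip a b (sparse_sum e t)"
    using assms(2) by (simp add: X_def R_def matrix_mul_assoc)
  ultimately show ?thesis unfolding one_big_def using assms(1) by (metis Suc_eq_plus1)
qed

lemma one_big_mult:
  assumes "one_big i j x" "near_rat h (M i) (err i)"
  shows "one_big i (Suc j) (x ** h)"
proof -
  obtain y z k m where *: "k + m = j" "low i k y" "low i m z" "x = y ** boost a b (2 ^ T i) ** z"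
    using assms(1) unfolding one_big_def by blast
  have "x ** h = y ** boost a b (2 ^ T i) ** (z ** h)" by (simp add: *(4) matrix_mul_assoc)
  then show ?thesis unfolding one_big_def using *(1,2) low_mult[OF *(3) assms(2)] by (metis add_Suc_right)
qed

text \<open>With \<open>N = n * e i\<close>, the product of \<open>n\<close> small steps has height
  \<open>M i ^ n = 2 ^ (2 * N + n)\<close>. The boost exponent \<open>9 * N\<close> beats this
  contraction loss, and the exponent \<open>40 * N\<close> in the next denominator beats everything
  that amplifies the error.\<close>

lemma size_estimate:
  assumes "n = e i ^ c"
  shows "M i ^ (2 * n) / 2 ^ T i + 2 ^ T i * real n * err i * M i ^ (4 * n) \<le> 2 / 2 ^ e i"
proof -
  define N where "N = e i ^ Suc c"
  have N: "n * e i = N" "e i \<le> N" using assms e_le_power[of i] by (simp_all add: N_def)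
  then have "1 \<le> N" "i < N" using e_pos[of i] index_less_e[of i] by linarith+
  note N = N this
  have nN: "n \<le> N" using N(1) e_pos[of i] by (metis Suc_leI mult.right_neutral mult_le_mono2 One_nat_def)
  have TN: "T i = 9 * N" by (simp add: T_def N_def)
  have "M i ^ (2 * n) * 2 ^ e i = 2 ^ (4 * N + 2 * n + e i)"
    using N(1) by (simp add: M_def algebra_simps flip: power_add power_mult)
  \<comment> \<open>The exponent is at most \<open>7 * N\<close>, because \<open>n\<close> and
    \<open>e i\<close> are at most \<open>N\<close>.\<close>
  also have "\<dots> \<le> 2 ^ T i" using N(2-4) nN TN by (intro power_increasing) linarith+
  finally have 1: "M i ^ (2 * n) / 2 ^ T i \<le> 1 / 2 ^ e i" by (simp add: field_simps)
  have "2 ^ T i * real n * (2 ^ e i * 2 ^ (i + 2)) * M i ^ (4 * n) * 2 ^ e i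
      \<le> 2 ^ T i * 2 ^ n * (2 ^ e i * 2 ^ (i + 2)) * M i ^ (4 * n) * 2 ^ e i"
    using M_ge1[of i] by (intro mult_right_mono mult_left_mono) (auto simp: less_imp_le[OF of_nat_less_two_power])
  also have "\<dots> = 2 ^ (9 * N + n + e i + (i + 2) + (8 * N + 4 * n) + e i)"
    using N(1) by (simp add: M_def TN algebra_simps flip: power_add power_mult)
  \<comment> \<open>Bounding \<open>n\<close>, \<open>e i\<close> and \<open>i\<close> by
    \<open>N\<close> gives an exponent of at most \<open>26 * N\<close>.\<close>
  also have "\<dots> \<le> 2 ^ e (Suc i)"
    using N(2-4) nN e_Suc_ge[of i, folded N_def] by (intro power_increasing) linarith+
  finally have 2: "2 ^ T i * real n * err i * M i ^ (4 * n) \<le> 1 / 2 ^ e i"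
    by (simp add: err_def field_simps)
  show ?thesis using 1 2 by simp
qed

lemma one_big_escapes:
  assumes "one_big i k x" "k \<le> e i ^ c" "2 / 2 ^ e i < \<epsilon>"
  shows "x \<notin> no_short \<epsilon>"
proof -
  obtain y z j m where *: "j + m = k" "low i j y" "low i m z" "x = y ** boost a b (2 ^ T i) ** z"
    using assms(1) unfolding one_big_def by blast
  have "mbound y (M i ^ j)" using *(2) unfolding low_def near_rat_def by blast
  then obtain v where "int_vec v" "v \<noteq> 0"
    "norm (x *v v) \<le> M i ^ (2 * e i ^ c) / 2 ^ T i + 2 ^ T i * real (e i ^ c) * err i * M i ^ (4 * e i ^ c)"
    using short_vector[OF _ *(3)[unfolded low_def] M_ge1 err_nonneg, of y j "e i ^ c" a b "T i"] *(1,4) assms(2)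
    by blast
  then show ?thesis using size_estimate[OF refl, of i] assms(3) unfolding no_short_def by force
qed

section \<open>Weights and the law of a single step\<close>

definition w :: "nat \<Rightarrow> real" where "w l = 1 / real (e l) ^ c"

lemma w_pos: "0 < w l"
  using e_pos[of l] by (simp add: w_def)

lemma w_Suc: "w (Suc l) \<le> w l / 2"
proof -
  have "2 * real (e l) ^ c \<le> (2 * real (e l)) ^ c"
    using c_pos self_le_power[of "2::real" c] by (simp add: power_mult_distrib mult_right_mono)
  also have "\<dots> \<le> real (e (Suc l)) ^ c"
    using e_double[of l] by (intro power_mono) simp_all
  finally show ?thesis unfolding w_def using e_pos[of l]
    by (simp add: frac_le)
qed

lemma w_add: "w (l + i) \<le> w i * (1 / 2) ^ l"
proof (induction l)
  case (Suc l)
  then show ?case using w_Suc[of "l + i"] by simp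
qed simp

lemma summable_w: "summable (\<lambda>l. w (l + i))"
proof (rule summable_comparison_test')
  show "summable (\<lambda>l. w i * (1 / 2) ^ l)" by (intro summable_mult summable_geometric) simp
  show "norm (w (l + i)) \<le> w i * (1 / 2) ^ l" for l
    using w_add[of l i] w_pos[of "l + i"] by simp
qed

text \<open>The weights at least halve at each index. So meeting any index at least \<open>i\<close>
  is, up to a factor two, no likelier than meeting \<open>i\<close> itself, and both happen on the
  same time scale.\<close>

lemma w_tail: "(\<Sum>l. w (l + i)) \<le> 2 * w i"
proof -
  have "(\<Sum>l. w (l + i)) \<le> (\<Sum>l. w i * (1 / 2) ^ l)"
    by (intro suminf_le w_add summable_w summable_mult summable_geometric) simp
  also have "\<dots> = w i * (\<Sum>l. (1 / 2) ^ l)" by (intro suminf_mult summable_geometric) simp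
  finally show ?thesis by (simp add: suminf_geometric)
qed

definition Z :: real where "Z = (\<Sum>l. w l)"

lemma Z_pos: "0 < Z"
  unfolding Z_def using summable_w[of 0] w_pos by (intro suminf_pos) auto

definition P :: "nat pmf" where "P = embed_pmf (\<lambda>l. w l / Z)"

lemma pmf_P: "pmf P l = w l / Z"
  unfolding P_def
proof (rule pmf_embed_pmf)
  show "0 \<le> w l / Z" for l using w_pos[of l] Z_pos by simp
  have "(\<Sum>l. w l / Z) = 1"
    using suminf_divide[of w Z] summable_w[of 0] Z_pos by (simp add: Z_def)
  moreover have "summable (\<lambda>l. w l / Z)" using summable_w[of 0] by (simp add: summable_divide)
  ultimately show "(\<integral>\<^sup>+ l. ennreal (w l / Z) \<partial>count_space UNIV) = 1"
    using w_pos Z_pos by (simp add: nn_integral_count_space_nat suminf_ennreal2 less_imp_le)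
qed

lemma P_lower: "measure_pmf.prob P {..<i} \<ge> 1 - 2 * w i / Z"
proof -
  have "Z = (\<Sum>l. w (l + i)) + (\<Sum>l<i. w l)"
    unfolding Z_def using summable_w[of 0] by (intro suminf_split_initial_segment) simp
  then have "Z - 2 * w i \<le> (\<Sum>l<i. w l)" using w_tail[of i] by linarith
  then have "(Z - 2 * w i) / Z \<le> (\<Sum>l<i. w l) / Z" using Z_pos by (intro divide_right_mono) auto
  then show ?thesis using Z_pos
    by (simp add: measure_measure_pmf_finite pmf_P diff_divide_distrib flip: sum_divide_distrib)
qed

definition Q :: "(nat \<times> bool) pmf" where "Q = pair_pmf P (bernoulli_pmf (1 / 2))"

definition unif :: "real measure" where "unif = restrict_space lborel {0<..<1}"

lemma space_unif [simp]: "space unif = {0<..<1}"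
  by (simp add: unif_def)

lemma emeasure_unif: "A \<subseteq> {0<..<1} \<Longrightarrow> emeasure unif A = emeasure lborel A"
  unfolding unif_def by (subst emeasure_restrict_space) auto

sublocale unif: prob_space unif
proof
  show "emeasure unif (space unif) = 1" using emeasure_unif[of "{0<..<1}"] by simp
qed

lemma sets_unif: "{0<..<1} \<in> sets unif"
  using sets.top[of unif] by simp

definition \<Omega> :: "((nat \<times> bool) \<times> real) measure" where "\<Omega> = measure_pmf Q \<Otimes>\<^sub>M unif"

sublocale \<Omega>: pair_prob_space "measure_pmf Q" unif ..

lemma space_\<Omega>: "space \<Omega> = UNIV \<times> {0<..<1}"
  by (simp add: \<Omega>_def space_pair_measure)

lemma prob_\<Omega>: "prob_space \<Omega>"
  unfolding \<Omega>_def by (rule \<Omega>.prob_space_axioms)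

lemma sets_\<Omega>: "sets \<Omega> = sets (count_space UNIV \<Otimes>\<^sub>M unif)"
  unfolding \<Omega>_def by (rule sets_pair_measure_cong) auto

lemma sparse_sum_unif: "sparse_sum e \<in> borel_measurable unif"
  unfolding unif_def by (rule measurable_restrict_space1) simp

lemma continuous_on_unip:
  fixes f :: "'x::topological_space \<Rightarrow> real"
  assumes "continuous_on S f"
  shows "continuous_on S (\<lambda>s. unip a b (f s))"
  unfolding unip_def
  apply (intro continuous_on_vec_lambda continuous_on_add continuous_on_const)
  subgoal for i j
    by (cases "i = a \<and> j = b") (use assms in auto)
  done

lemma continuous_on_matrix_mult:
  fixes f g :: "'x::topological_space \<Rightarrow> real ^ 'n ^ 'n"
  assumes "continuous_on S f" "continuous_on S g"
  shows "continuous_on S (\<lambda>s. f s ** g s)"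
  unfolding matrix_matrix_mult_def by (intro continuous_intros assms)

text \<open>For each of the countably many pairs of index and bit, the step is a continuous function
  of the measurable number \<open>sparse_sum e x\<close>.\<close>

lemma measurable_X: "X \<in> \<Omega> \<rightarrow>\<^sub>M SL_borel"
proof -
  have "(\<lambda>x. X ((l, \<sigma>), x)) \<in> borel_measurable unif" for l \<sigma>
  proof -
    define F where "F s = (if \<sigma> then R l ** unip a b s else unip a b (- s) ** matrix_inv (R l))" for s
    have "continuous_on UNIV F"
      unfolding F_def
      by (cases \<sigma>) (auto intro!: continuous_on_matrix_mult continuous_on_unip continuous_intros)
    then have "F \<in> borel_measurable borel" by (rule borel_measurable_continuous_onI)
    from measurable_compose[OF sparse_sum_unif this] show ?thesis by (simp add: F_def X_def)
  qed
  then have "X \<in> borel_measurable (count_space UNIV \<Otimes>\<^sub>M unif)"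
    by (intro measurable_pair_measure_countable1) auto
  then have "X \<in> borel_measurable \<Omega>" using measurable_cong_sets[OF sets_\<Omega> refl] by blast
  then show ?thesis unfolding SL_borel_def by (intro measurable_restrict_space2) (auto simp: X_SL)
qed

definition \<mu> :: "(real ^ 'n ^ 'n) measure" where "\<mu> = distr \<Omega> SL_borel X"

lemma SL_prob_\<mu>: "SL_prob \<mu>"
  using prob_space.prob_space_distr[OF prob_\<Omega> measurable_X] by (simp add: SL_prob_def \<mu>_def)

lemma emeasure_index: "emeasure \<Omega> (A \<times> {0<..<1}) = emeasure (measure_pmf Q) A"
proof -
  have "emeasure \<Omega> (A \<times> space unif) = emeasure (measure_pmf Q) A * emeasure unif (space unif)"
    unfolding \<Omega>_def by (rule unif.emeasure_pair_measure_Times) (auto simp: sets_unif)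
  then show ?thesis using unif.emeasure_space_1 by simp
qed

lemma index_sets: "A \<times> {0<..<1} \<in> sets \<Omega>"
  unfolding \<Omega>_def by (intro pair_measureI sets_unif) simp

section \<open>Escape from compact sets along a subsequence\<close>

text \<open>The binomial bound is applied with \<open>B\<close> drawing index \<open>i\<close>
  uninverted, of probability \<open>w i / (2 * Z)\<close>, and \<open>L\<close> drawing a smaller
  index with either bit, of probability at least \<open>1 - 2 * w i / Z\<close>. The last hypothesis
  keeps the base of the power nonnegative.\<close>

lemma escape_probability:
  assumes "even i" "k \<le> e i ^ c" "2 / 2 ^ e i < \<epsilon>" "2 * w i / Z \<le> 1"
  shows "measure (SL_conv_power \<mu> k) (no_short \<epsilon>)
    \<le> 1 - real k * (w i / (2 * Z)) * (1 - 2 * w i / Z) ^ (k - 1)"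
proof -
  interpret k: prob_space "SL_conv_power \<mu> k"
    using SL_prob_conv_power[OF SL_prob_\<mu>] by (simp add: SL_prob_def)
  have sk: "sets (SL_conv_power \<mu> k) = sets SL_borel"
    using SL_prob_conv_power[OF SL_prob_\<mu>] by (simp add: SL_prob_def)
  then have spk: "space (SL_conv_power \<mu> k) = SL" using sets_eq_imp_space_eq[OF sk] by simp
  define L where "L = ({..<i} \<times> (UNIV :: bool set)) \<times> {0<..<1::real}"
  define B where "B = {(i, True)} \<times> {0<..<1::real}"
  have C: "SL - no_short \<epsilon> \<in> sets SL_borel"
    using sets.compl_sets[OF no_short_sets[of \<epsilon>]] by simp
  have bound: "of_nat k * emeasure \<Omega> B * emeasure \<Omega> L ^ (k - 1)
      \<le> emeasure (SL_conv_power (distr \<Omega> SL_borel X) k) (SL - no_short \<epsilon>)"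
  proof (rule SL_conv_power_lower_bound[where P = "low i" and Q = "one_big i", OF prob_\<Omega> measurable_X])
    show "L \<in> sets \<Omega>" "B \<in> sets \<Omega>" unfolding L_def B_def by (rule index_sets)+
    show "L \<inter> B = {}" by (auto simp: L_def B_def)
    show "SL - no_short \<epsilon> \<in> sets SL_borel" by (rule C)
    show "low i 0 (mat 1)" by (rule low_0)
    have L: "near_rat (X \<omega>) (M i) (err i)" if "\<omega> \<in> L" for \<omega>
      using that near_rat_lower_step by (auto simp: L_def)
    show "low i (Suc j) (x ** X \<omega>)" if "low i j x" "\<omega> \<in> L" for j x \<omega>
      using that L low_mult by blast
    show "one_big i (Suc j) (x ** X \<omega>)" if "one_big i j x" "\<omega> \<in> L" for j x \<omega>
      using that L one_big_mult by blast
    show "one_big i (Suc j) (x ** X \<omega>)" if "low i j x" "\<omega> \<in> B" for j x \<omega>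
      using that low_big[OF _ assms(1)] by (auto simp: B_def)
    show "x \<in> SL - no_short \<epsilon>" if "one_big i k x" "x \<in> SL" for x
      using one_big_escapes[OF that(1) assms(2,3)] that(2) by blast
  qed
  have w: "0 \<le> w i / (2 * Z)" using w_pos[of i] Z_pos by simp
  have "emeasure \<Omega> B = pmf Q (i, True)" unfolding B_def emeasure_index by (simp add: emeasure_pmf_single)
  then have eB: "emeasure \<Omega> B = ennreal (w i / (2 * Z))"
    by (simp add: Q_def pmf_pair pmf_P mult.commute)
  have "emeasure \<Omega> L = emeasure (map_pmf fst Q) {..<i}"
    unfolding L_def emeasure_index by (simp add: vimage_fst)
  also have "\<dots> = measure_pmf.prob P {..<i}"
    by (simp add: Q_def map_fst_pair_pmf measure_pmf.emeasure_eq_measure)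
  finally have eL: "ennreal (1 - 2 * w i / Z) \<le> emeasure \<Omega> L" using P_lower[of i] by (simp add: ennreal_leI)
  have "ennreal (real k * (w i / (2 * Z)) * (1 - 2 * w i / Z) ^ (k - 1))
      = of_nat k * ennreal (w i / (2 * Z)) * ennreal (1 - 2 * w i / Z) ^ (k - 1)"
  proof -
    have "ennreal (real k * u * v ^ m) = of_nat k * ennreal u * ennreal v ^ m" if "0 \<le> u" "0 \<le> v" for u v m
      using that by (simp add: ennreal_mult ennreal_power ennreal_of_nat_eq_real_of_nat)
    from this[OF w, of "1 - 2 * w i / Z" "k - 1"] show ?thesis using assms(4) by linarith
  qed
  also have "\<dots> \<le> of_nat k * emeasure \<Omega> B * emeasure \<Omega> L ^ (k - 1)"
    unfolding eB using eL by (intro mult_left_mono power_mono) auto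
  also have "\<dots> \<le> ennreal (k.prob (SL - no_short \<epsilon>))"
    using bound by (simp add: \<mu>_def[symmetric] k.emeasure_eq_measure)
  finally have "real k * (w i / (2 * Z)) * (1 - 2 * w i / Z) ^ (k - 1) \<le> k.prob (SL - no_short \<epsilon>)"
    by (simp add: ennreal_le_iff)
  moreover have "k.prob (SL - no_short \<epsilon>) = 1 - k.prob (no_short \<epsilon>)"
    using k.prob_compl[of "no_short \<epsilon>"] sk spk by simp
  ultimately show ?thesis by linarith
qed

text \<open>The exponential bounds the probability that all other steps are small; the factor
  \<open>1 / (2 * Z)\<close> of the big step is halved again by averaging over times up to
  \<open>n\<close>.\<close>

definition esc :: real where "esc = exp (- 4 / Z) / (4 * Z)"

lemma esc_pos: "0 < esc"
  using Z_pos by (simp add: esc_def)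

text \<open>Uses \<open>exp (- 2 * y) \<le> 1 - y\<close> for \<open>y\<close> between
  \<open>0\<close> and \<open>1 / 2\<close>, with \<open>y * n = 2 / Z\<close>; the first hypothesis
  ensures \<open>y \<le> 1 / 2\<close>.\<close>

lemma power_lower_bound:
  assumes "4 / Z \<le> real n" "k \<le> n" "0 < n"
  shows "exp (- 4 / Z) \<le> (1 - 2 * (1 / real n) / Z) ^ k"
proof -
  define y where "y = 2 * (1 / real n) / Z"
  have y: "0 \<le> y" "y \<le> 1 / 2" "y * real n = 2 / Z"
    using assms Z_pos by (auto simp: y_def field_simps)
  have "1 \<le> (1 - y) * (1 + 2 * y)"
    using mult_nonneg_nonneg[of y "1 - 2 * y"] y(1,2) by (simp add: algebra_simps)
  also have "\<dots> \<le> (1 - y) * exp (2 * y)" using y(2) by (intro mult_left_mono exp_ge_add_one_self) auto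
  finally have "exp (- 2 * y) \<le> 1 - y" by (simp add: exp_minus field_simps)
  then have "exp (- 2 * y) ^ k \<le> (1 - y) ^ k" by (intro power_mono) auto
  moreover have "exp (- 4 / Z) \<le> exp (- 2 * y) ^ k"
  proof -
    have "y * real k \<le> 2 / Z" unfolding y(3)[symmetric] using y(1) assms(2) by (intro mult_left_mono) auto
    then have "- 4 / Z \<le> real k * (- 2 * y)" by (simp add: mult.commute mult.left_commute)
    then show ?thesis by (simp flip: exp_of_nat_mult)
  qed
  ultimately show ?thesis by (simp add: y_def)
qed

text \<open>Here \<open>w i = 1 / n\<close>, so the probability of having escaped at time
  \<open>k\<close> is at least \<open>2 * esc * k / n\<close>, and the average of \<open>k\<close>
  over \<open>1..n\<close> exceeds \<open>n / 2\<close>.\<close>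

lemma average_bound:
  assumes "even i" "2 / 2 ^ e i < \<epsilon>" "4 / Z \<le> real (e i ^ c)" "A \<subseteq> no_short \<epsilon>" "n = e i ^ c"
  shows "1 / real n * (\<Sum>k = 1..n. measure (SL_conv_power \<mu> k) A) \<le> 1 - esc"
proof -
  have n0: "0 < n" using assms(5) e_pos[of i] by simp
  have wn: "w i = 1 / real n" by (simp add: w_def assms(5))
  have le1: "2 * w i / Z \<le> 1"
  proof -
    have "4 \<le> real n * Z" using assms(3,5) Z_pos by (simp add: field_simps)
    then show ?thesis using n0 Z_pos by (simp add: wn field_simps)
  qed
  have "measure (SL_conv_power \<mu> k) A \<le> 1 - real k * (2 * esc / real n)" if k: "k \<in> {1..n}" for k
  proof -
    interpret k: prob_space "SL_conv_power \<mu> k"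
      using SL_prob_conv_power[OF SL_prob_\<mu>] by (simp add: SL_prob_def)
    have "no_short \<epsilon> \<in> sets (SL_conv_power \<mu> k)"
      using SL_prob_conv_power[OF SL_prob_\<mu>, of k] by (simp add: SL_prob_def)
    then have "measure (SL_conv_power \<mu> k) A \<le> measure (SL_conv_power \<mu> k) (no_short \<epsilon>)"
      by (rule k.finite_measure_mono[OF assms(4)])
    also have "\<dots> \<le> 1 - real k * (w i / (2 * Z)) * (1 - 2 * w i / Z) ^ (k - 1)"
      using k assms(5) by (intro escape_probability assms le1) auto
    also have "\<dots> \<le> 1 - real k * (w i / (2 * Z)) * exp (- 4 / Z)"
      using power_lower_bound[of n "k - 1"] assms(3,5) n0 k Z_pos w_pos[of i] unfolding wn
      by (intro diff_left_mono mult_left_mono) auto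
    also have "\<dots> = 1 - real k * (2 * esc / real n)"
      using Z_pos by (simp add: wn esc_def)
    finally show ?thesis .
  qed
  then have "(\<Sum>k = 1..n. measure (SL_conv_power \<mu> k) A) \<le> (\<Sum>k = 1..n. 1 - real k * (2 * esc / real n))"
    by (rule sum_mono)
  also have "\<dots> = real n - (\<Sum>k = 1..n. real k) * (2 * esc / real n)"
    by (simp add: sum_subtractf sum_distrib_right sum_divide_distrib)
  also have "(\<Sum>k = 1..n. real k) = real n * (real n + 1) / 2"
    by (induction n) (auto simp: field_simps)
  also have "real n - real n * (real n + 1) / 2 * (2 * esc / real n) \<le> real n * (1 - esc)"
    using n0 esc_pos by (simp add: field_simps)
  finally show ?thesis using n0 by (simp add: field_simps)
qed

lemma e_power_strict_mono: "strict_mono (\<lambda>m. e (2 * m) ^ c)"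
proof (rule strict_mono_Suc_iff[THEN iffD2], rule allI)
  fix m
  have "e (2 * m) < e (2 * Suc m)" using e_add[of "2 * m" 2] by simp
  then show "e (2 * m) ^ c < e (2 * Suc m) ^ c" using c_pos by (intro power_strict_mono) auto
qed

text \<open>A liminf is at most the liminf along a subsequence; the times \<open>e i ^ c\<close>
  with \<open>i\<close> even are the ones at which a boost has just had time to occur.\<close>

lemma liminf_bound:
  assumes "compactin SL_quotient K"
  shows "liminf (\<lambda>n. ereal (1 / real n *
    (\<Sum>k = 1..n. measure (SL_conv_power \<mu> k) (coset_preimage K)))) \<le> ereal (1 - esc)"
proof -
  obtain \<epsilon> where \<epsilon>: "0 < \<epsilon>" "coset_preimage K \<subseteq> no_short \<epsilon>" using compact_no_short[OF assms] by blast
  define u where "u n = ereal (1 / real n * (\<Sum>k = 1..n. measure (SL_conv_power \<mu> k) (coset_preimage K)))" for n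
  have "liminf u \<le> liminf (u \<circ> (\<lambda>m. e (2 * m) ^ c))"
    by (rule liminf_subseq_mono[OF e_power_strict_mono])
  also have "\<dots> \<le> ereal (1 - esc)"
  proof -
    have ev: "eventually (\<lambda>m. (u \<circ> (\<lambda>m. e (2 * m) ^ c)) m \<le> ereal (1 - esc)) sequentially"
    proof -
      \<comment> \<open>From \<open>m1\<close> on the vectors are shorter than
        \<open>\<epsilon>\<close>; from \<open>m2\<close> on the time is large enough for the
        exponential estimate.\<close>
      obtain m1 :: nat where m1: "2 / \<epsilon> < 2 ^ m1" using real_arch_pow[of 2 "2 / \<epsilon>"] by auto
      obtain m2 :: nat where m2: "4 / Z < real m2" using reals_Archimedean2 by blast
      show ?thesis
      proof (rule eventually_sequentiallyI[of "max m1 m2"])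
        fix m assume m: "max m1 m2 \<le> m"
        have em: "m < e (2 * m)" using index_less_e[of "2 * m"] by linarith
        have "(2::real) ^ m1 \<le> 2 ^ e (2 * m)" using m em by (intro power_increasing) auto
        then have "2 / \<epsilon> < 2 ^ e (2 * m)" using m1 by linarith
        then have 1: "2 / 2 ^ e (2 * m) < \<epsilon>" using \<epsilon>(1) by (simp add: field_simps)
        have "e (2 * m) \<le> e (2 * m) ^ c" using c_pos e_pos[of "2 * m"] by (intro self_le_power) auto
        then have "real m2 \<le> real (e (2 * m) ^ c)" using m em by (intro of_nat_mono) linarith
        then have 2: "4 / Z \<le> real (e (2 * m) ^ c)" using m2 by linarith
        show "(u \<circ> (\<lambda>m. e (2 * m) ^ c)) m \<le> ereal (1 - esc)"
          using average_bound[OF _ 1 2 \<epsilon>(2) refl] by (simp add: u_def)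
      qed
    qed
    have "liminf (u \<circ> (\<lambda>m. e (2 * m) ^ c)) \<le> liminf (\<lambda>m::nat. ereal (1 - esc))"
      by (rule Liminf_mono[OF ev])
    then show ?thesis by (simp add: Liminf_const)
  qed
  finally show ?thesis by (simp add: u_def[abs_def])
qed


section \<open>Symmetry\<close>

lemma bernoulli_Not: "map_pmf Not (bernoulli_pmf (1 / 2)) = bernoulli_pmf (1 / 2)"
proof (rule pmf_eqI)
  fix \<sigma>
  have "pmf (map_pmf Not (bernoulli_pmf (1 / 2))) (\<not> \<not> \<sigma>) = pmf (bernoulli_pmf (1 / 2)) (\<not> \<sigma>)"
    by (rule pmf_map_inj') (auto intro: injI)
  then show "pmf (map_pmf Not (bernoulli_pmf (1 / 2))) \<sigma> = pmf (bernoulli_pmf (1 / 2)) \<sigma>"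
    by (cases \<sigma>) simp_all
qed

definition flip :: "nat \<times> bool \<Rightarrow> nat \<times> bool" where "flip = (\<lambda>(l, \<sigma>). (l, \<not> \<sigma>))"

lemma flip_Q: "map_pmf flip Q = Q"
  using map_pair[of id Not P "bernoulli_pmf (1 / 2)"]
  by (simp add: flip_def Q_def bernoulli_Not map_pmf_id)

lemma flip_\<Omega>:
  "(\<lambda>(j, x). (flip j, x)) \<in> \<Omega> \<rightarrow>\<^sub>M \<Omega>" "distr \<Omega> \<Omega> (\<lambda>(j, x). (flip j, x)) = \<Omega>"
proof -
  have 1: "flip \<in> measure_pmf Q \<rightarrow>\<^sub>M measure_pmf Q" and 2: "(\<lambda>x. x) \<in> unif \<rightarrow>\<^sub>M unif" by simp_all
  show "(\<lambda>(j, x). (flip j, x)) \<in> \<Omega> \<rightarrow>\<^sub>M \<Omega>" unfolding \<Omega>_def by measurable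
  have "distr (measure_pmf Q) (measure_pmf Q) flip = distr (measure_pmf Q) (count_space UNIV) flip"
    by (rule distr_cong) simp_all
  also have "\<dots> = measure_pmf Q" using flip_Q map_pmf_rep_eq[of flip Q] by simp
  finally have d1: "distr (measure_pmf Q) (measure_pmf Q) flip = measure_pmf Q" .
  have d2: "distr unif unif (\<lambda>x. x) = unif" by (rule distr_id)
  have "distr (measure_pmf Q) (measure_pmf Q) flip \<Otimes>\<^sub>M distr unif unif (\<lambda>x. x)
      = distr (measure_pmf Q \<Otimes>\<^sub>M unif) (measure_pmf Q \<Otimes>\<^sub>M unif) (\<lambda>(j, x). (flip j, x))"
    by (rule pair_measure_distr[OF 1 2]) (simp add: d2 unif.sigma_finite_measure_axioms)
  then show "distr \<Omega> \<Omega> (\<lambda>(j, x). (flip j, x)) = \<Omega>" unfolding d1 d2 \<Omega>_def by simp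
qed

text \<open>Inverting a step amounts to flipping its bit, and the bit is fair and independent of the
  index and of the parameter.\<close>

lemma symmetric_\<mu>: "symmetric_measure \<mu>"
proof -
  have X_flip: "matrix_inv (X \<omega>) = (X \<circ> (\<lambda>(j, x). (flip j, x))) \<omega>" for \<omega>
    using matrix_inv_eq[OF X_inverse, of "fst (fst \<omega>)" "snd (fst \<omega>)" "snd \<omega>"]
    by (simp add: flip_def split_beta)
  have "distr \<mu> SL_borel matrix_inv = distr \<Omega> SL_borel (matrix_inv \<circ> X)"
    unfolding \<mu>_def by (rule distr_distr[OF measurable_matrix_inv measurable_X])
  also have "matrix_inv \<circ> X = X \<circ> (\<lambda>(j, x). (flip j, x))" using X_flip by (simp add: fun_eq_iff)
  also have "distr \<Omega> SL_borel \<dots> = distr (distr \<Omega> \<Omega> (\<lambda>(j, x). (flip j, x))) SL_borel X"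
    using distr_distr[OF measurable_X flip_\<Omega>(1)] by simp
  finally show ?thesis unfolding symmetric_measure_def flip_\<Omega>(2) \<mu>_def .
qed

section \<open>Absence of atoms and full support\<close>

lemma emeasure_\<Omega>:
  assumes "A \<in> sets \<Omega>"
  shows "emeasure \<Omega> A = (\<integral>\<^sup>+ j. emeasure unif (Pair j -` A) \<partial>measure_pmf Q)"
  using assms unfolding \<Omega>_def by (rule unif.emeasure_pair_measure_alt)

text \<open>Inversion reduces to the uninverted case; cancelling \<open>R l\<close> leaves the
  unipotent factor, and the sparse sum is strictly increasing.\<close>

lemma X_inj:
  assumes "0 < x" "x < 1" "0 < y" "y < 1" "X (j, x) = X (j, y)"
  shows "x = y"
proof -
  obtain l \<sigma> where j: "j = (l, \<sigma>)" by (cases j)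
  have inv: "matrix_inv (X (j, z)) = X ((l, \<not> \<sigma>), z)" for z
    unfolding j by (rule matrix_inv_eq[OF X_inverse])
  have "X ((l, \<not> \<sigma>), x) = X ((l, \<not> \<sigma>), y)" using inv assms(5) by metis
  then have "X ((l, True), x) = X ((l, True), y)" using assms(5) j by (cases \<sigma>) auto
  then have "matrix_inv (R l) ** (R l ** unip a b (sparse_sum e x)) = matrix_inv (R l) ** (R l ** unip a b (sparse_sum e y))"
    by (simp add: X_def)
  then have "unip a b (sparse_sum e x) = unip a b (sparse_sum e y)"
    using SL_is_inverse[OF R_SL[of l]] by (simp add: matrix_mul_assoc is_inverse_def)
  then have "sparse_sum e x = sparse_sum e y" using unip_inj ab by blast
  then show ?thesis
    using sparse_sum_less[of x y] sparse_sum_less[of y x] assms(1-4) by (cases x y rule: linorder_cases) auto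
qed

lemma emeasure_\<mu>:
  assumes "A \<in> sets SL_borel"
  shows "emeasure \<mu> A = (\<integral>\<^sup>+ j. emeasure unif {x \<in> {0<..<1}. X (j, x) \<in> A} \<partial>measure_pmf Q)"
proof -
  have fibre: "Pair j -` (X -` A \<inter> space \<Omega>) = {x \<in> {0<..<1}. X (j, x) \<in> A}" for j
    by (auto simp: space_\<Omega>)
  have "emeasure \<mu> A = emeasure \<Omega> (X -` A \<inter> space \<Omega>)"
    unfolding \<mu>_def by (rule emeasure_distr[OF measurable_X assms])
  also have "\<dots> = (\<integral>\<^sup>+ j. emeasure unif (Pair j -` (X -` A \<inter> space \<Omega>)) \<partial>measure_pmf Q)"
    by (rule emeasure_\<Omega>[OF measurable_sets[OF measurable_X assms]])
  finally show ?thesis by (simp only: fibre)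
qed

lemma space_\<mu>: "space \<mu> = SL"
  by (simp add: \<mu>_def)

text \<open>For each index and bit at most one parameter yields a given matrix, so every fibre is
  Lebesgue null.\<close>

lemma no_atoms_\<mu>: "no_atoms \<mu>"
  unfolding no_atoms_def space_\<mu>
proof
  fix g :: "real ^ 'n ^ 'n" assume g: "g \<in> SL"
  have "{g} \<in> sets SL_borel"
    using g by (auto simp: SL_borel_def sets_restrict_space intro!: image_eqI[of _ _ "{g}"])
  then have *: "emeasure \<mu> {g} = (\<integral>\<^sup>+ j. emeasure unif {x \<in> {0<..<1}. X (j, x) \<in> {g}} \<partial>measure_pmf Q)"
    by (rule emeasure_\<mu>)
  have null: "emeasure unif {x \<in> {0<..<1}. X (j, x) \<in> {g}} = 0" for j
  proof -
    let ?S = "{x \<in> {0<..<1}. X (j, x) \<in> {g}}"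
    have "\<exists>y. ?S \<subseteq> {y}"
    proof (cases "?S = {}")
      case False
      then obtain y where y: "y \<in> ?S" by blast
      have "?S \<subseteq> {y}" using y X_inj[of _ y j] by auto
      then show ?thesis ..
    qed blast
    then have "countable ?S" by (meson countable_empty countable_insert countable_subset)
    then have "emeasure lborel ?S = 0" by (rule emeasure_lborel_countable)
    moreover have "emeasure unif ?S = emeasure lborel ?S" by (rule emeasure_unif) blast
    ultimately show ?thesis by (simp only:)
  qed
  show "emeasure \<mu> {g} = 0" unfolding * null by simp
qed

lemma Q_pos: "0 < pmf Q (l, \<sigma>)"
  using w_pos[of l] Z_pos by (cases \<sigma>) (simp_all add: Q_def pmf_pair pmf_P)

text \<open>Some \<open>X\<close>-fibre over an open set is not null, as the countably many dense matrices \<open>r l\<close> cover every parameter.\<close>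

lemma support_\<mu>: "measure_support \<mu> = SL"
proof -
  have "0 < emeasure \<mu> (U \<inter> SL)" if g: "g \<in> SL" and U: "open U" "g \<in> U" for g :: "real ^ 'n ^ 'n" and U
  proof (rule ccontr)
    assume "\<not> 0 < emeasure \<mu> (U \<inter> SL)"
    have US: "U \<inter> SL \<in> sets SL_borel"
      using U(1) by (auto simp: SL_borel_def sets_restrict_space Int_commute)
    define S where "S j = {x \<in> {0<..<1}. X (j, x) \<in> U \<inter> SL}" for j
    have S_sets: "S j \<in> sets unif" for j
    proof -
      have "S j = Pair j -` (X -` (U \<inter> SL) \<inter> space \<Omega>)" by (auto simp: S_def space_\<Omega>)
      also have "\<dots> \<in> sets unif"
        using measurable_sets[OF measurable_X US] unfolding \<Omega>_def by (rule sets_Pair1)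
      finally show ?thesis .
    qed
    have "(\<integral>\<^sup>+ j. emeasure unif (S j) \<partial>measure_pmf Q) = 0"
      using emeasure_\<mu>[OF US] \<open>\<not> 0 < emeasure \<mu> (U \<inter> SL)\<close> by (simp add: S_def zero_less_iff_neq_zero)
    then have "AE j in measure_pmf Q. emeasure unif (S j) = 0"
      by (subst (asm) nn_integral_0_iff_AE) auto
    \<comment> \<open>Every pair of index and bit has positive mass, so almost everywhere means
      everywhere.\<close>
    then have "emeasure unif (S (l, True)) = 0" for l
      using Q_pos[of l True] by (simp add: AE_measure_pmf_iff set_pmf_iff)
    then have "emeasure unif (\<Union>l. S (l, True)) = 0"
      using S_sets by (intro emeasure_UN_eq_0) auto
    moreover have "(\<Union>l. S (l, True)) = {0<..<1}"
    proof (intro subset_antisym subsetI)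
      fix x :: real assume x: "x \<in> {0<..<1}"
      let ?u = "unip a b (sparse_sum e x)" and ?u' = "unip a b (- sparse_sum e x)"
      let ?m = "\<lambda>h :: real ^ 'n ^ 'n. h ** ?u"
      have inv: "is_inverse ?u ?u'" by (rule unip_inverse[OF ab])
      \<comment> \<open>The translate of \<open>U\<close> by the inverse of \<open>?u\<close> is
        open and meets \<open>SL\<close> in \<open>g ** ?u'\<close>. Density puts some
        \<open>r l\<close> with \<open>l\<close> odd in it, so \<open>x\<close> lies in the fibre of
        that \<open>l\<close>.\<close>
      have "continuous_on UNIV ?m"
        by (rule continuous_on_matrix_mult) (auto intro: continuous_intros)
      then have "open (?m -` U)" by (rule open_vimage[OF U(1)])
      moreover have "g ** ?u' \<in> ?m -` U \<inter> SL"
        using inv U(2) g SL_mult[OF g unip_SL[OF ab]] by (simp add: is_inverse_def flip: matrix_mul_assoc)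
      ultimately obtain l where l: "odd l" "r l ** ?u \<in> U" using r_dense by blast
      then have "X ((l, True), x) \<in> U" by (simp add: X_def R_def)
      then show "x \<in> (\<Union>l. S (l, True))" using x by (auto simp: S_def X_SL)
    qed (auto simp: S_def)
    ultimately show False using unif.emeasure_space_1 by simp
  qed
  then show ?thesis by (auto simp: measure_support_def space_\<mu>)
qed

section \<open>The moment\<close>

text \<open>The same bound \<open>2 ^ T l * 2\<close> holds for a step and for its inverse, and the
  product of their norms is at least one; this bounds the logarithm from both sides.\<close>

lemma ln_onorm_X:
  assumes "0 < x" "x < 1"
  shows "\<bar>ln (onorm ((*v) (X ((l, \<sigma>), x))))\<bar> \<le> 10 * real (e l) ^ Suc c"
proof -
  define H :: real where "H = 2 ^ T l * 2"
  have H: "mbound (X ((l, \<tau>), x)) H" for \<tau>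
  proof -
    have s: "\<bar>sparse_sum e x\<bar> \<le> 1" using sparse_sum_bounds[OF assms] by simp
    have u: "mbound (unip a b (sparse_sum e x)) 2" "mbound (unip a b (- sparse_sum e x)) 2"
      using mbound_mono[OF mbound_unip, of "sparse_sum e x" 2] mbound_mono[OF mbound_unip, of "- sparse_sum e x" 2] s
      by simp_all
    have "mbound (R l) (2 ^ T l)" "mbound (matrix_inv (R l)) (2 ^ T l)"
      using height_le_mbound R_height height_le_inverse SL_is_inverse[OF R_SL] by blast+
    from mbound_mult[OF this(1) u(1)] mbound_mult[OF u(2) this(2)] show ?thesis
      by (simp add: X_def H_def mult.commute)
  qed
  let ?o = "onorm ((*v) (X ((l, \<sigma>), x)))"
  have H0: "1 \<le> H" unfolding H_def by (simp add: mult_ge1_I)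
  have "mbound (X ((l, \<sigma>), x) ** X ((l, \<not> \<sigma>), x)) (?o * H)"
    by (rule mbound_mult[OF mbound_onorm H])
  then have "1 \<le> ?o * H"
    using X_inverse[of l \<sigma> x] mboundD[of "mat 1" "?o * H" "axis a 1"] by (simp add: is_inverse_def)
  then have lower: "1 / H \<le> ?o" using H0 by (simp add: field_simps)
  then have pos: "0 < ?o" using H0 by (intro less_le_trans[OF _ lower]) simp
  have "ln ?o \<le> ln H" using pos onorm_le_mbound[OF H] by (intro ln_mono) auto
  moreover have "- ln H \<le> ln ?o" using ln_mono[OF lower] pos H0 by (simp add: ln_div)
  moreover have "ln H \<le> 10 * real (e l) ^ Suc c"
  proof -
    have "ln H = real (Suc (T l)) * ln 2" by (simp add: H_def ln_mult ln_realpow algebra_simps)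
    also have "\<dots> \<le> real (Suc (T l)) * 1" using ln_2_less_1 by (intro mult_left_mono) auto
    also have "\<dots> \<le> 10 * real (e l) ^ Suc c"
    proof -
      have "Suc (T l) \<le> 10 * e l ^ Suc c" using e_pos[of l] e_le_power[of l] unfolding T_def by linarith
      then have "real (Suc (T l)) \<le> real (10 * e l ^ Suc c)" by (rule of_nat_mono)
      then show ?thesis by simp
    qed
    finally show ?thesis .
  qed
  ultimately show ?thesis by linarith
qed

text \<open>The powers of \<open>e l\<close> combine to one with the negative exponent
  \<open>Suc c * p - c\<close>, and \<open>e l \<ge> 2 ^ l\<close> turns this into a geometric
  term.\<close>

lemma moment_term: "(10 * real (e l) ^ Suc c) powr p * (w l / Z) \<le> 10 powr p / Z * (2 powr (real (Suc c) * p - real c)) ^ l"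
proof -
  define \<theta> where "\<theta> = real (Suc c) * p - real c"
  have e0: "0 < real (e l)" using e_pos[of l] by simp
  have "(10 * real (e l) ^ Suc c) powr p = 10 powr p * real (e l) powr (real (Suc c) * p)"
    using e0 by (simp add: powr_mult powr_powr powr_realpow[symmetric] del: power_Suc)
  moreover have "w l = real (e l) powr (- real c)"
    using e0 by (simp add: w_def powr_minus powr_realpow field_simps)
  ultimately have "(10 * real (e l) ^ Suc c) powr p * (w l / Z) = 10 powr p / Z * real (e l) powr \<theta>"
    by (simp add: \<theta>_def diff_conv_add_uminus powr_add del: add_uminus_conv_diff)
  also have "\<dots> \<le> 10 powr p / Z * (2 ^ l) powr \<theta>"
  proof -
    have "(2::real) ^ l \<le> real (e l)" using two_pow_le_e[of l] by (metis of_nat_le_iff of_nat_numeral of_nat_power)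
    then have "real (e l) powr \<theta> \<le> (2 ^ l) powr \<theta>"
      using p_less by (intro powr_mono2') (auto simp: \<theta>_def)
    then show ?thesis using Z_pos by (intro mult_left_mono) auto
  qed
  also have "(2 ^ l :: real) powr \<theta> = (2 powr \<theta>) ^ l"
    by (simp add: powr_realpow[symmetric] powr_powr mult.commute)
  finally show ?thesis by (simp add: \<theta>_def)
qed

lemma moment_\<mu>: "finite_Lp_moment p \<mu>"
proof -
  define G where "G l = (10 * real (e l) ^ Suc c) powr p" for l
  define q where "q = 2 powr (real (Suc c) * p - real c)"
  have q: "0 \<le> q" "q < 1" using p_less by (auto simp: q_def powr_less_one)
  have "(\<lambda>g :: real ^ 'n ^ 'n. onorm ((*v) g)) \<in> borel_measurable SL_borel"
    unfolding SL_borel_def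
    by (intro measurable_restrict_space1 borel_measurable_continuous_onI continuous_on_onorm)
  then have m: "(\<lambda>g. ennreal (ln (onorm ((*v) g)) powr p)) \<in> borel_measurable (SL_borel :: (real ^ 'n ^ 'n) measure)"
    by measurable
  have "(\<integral>\<^sup>+ g. ennreal (ln (onorm ((*v) g)) powr p) \<partial>\<mu>) = (\<integral>\<^sup>+ \<omega>. ennreal (ln (onorm ((*v) (X \<omega>))) powr p) \<partial>\<Omega>)"
    unfolding \<mu>_def by (subst nn_integral_distr[OF measurable_X]) (use m in simp_all)
  also have "\<dots> \<le> (\<integral>\<^sup>+ \<omega>. ennreal (G (fst (fst \<omega>))) \<partial>\<Omega>)"
  proof (rule nn_integral_mono)
    fix \<omega> assume "\<omega> \<in> space \<Omega>"
    then obtain l \<sigma> x where \<omega>: "\<omega> = ((l, \<sigma>), x)" "0 < x" "x < 1" by (cases \<omega>) (auto simp: space_\<Omega>)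
    \<comment> \<open>Since \<open>powr\<close> ignores the sign of its base, the bound on the
      absolute value of the logarithm suffices.\<close>
    have "ln (onorm ((*v) (X \<omega>))) powr p = \<bar>ln (onorm ((*v) (X \<omega>)))\<bar> powr p"
      by (auto simp: powr_def abs_if ln_minus)
    also have "\<dots> \<le> G l"
      unfolding G_def \<omega>(1) using ln_onorm_X[OF \<omega>(2,3)] p_pos by (intro powr_mono2) auto
    finally show "ennreal (ln (onorm ((*v) (X \<omega>))) powr p) \<le> ennreal (G (fst (fst \<omega>)))"
      by (simp add: \<omega>(1) ennreal_leI)
  qed
  also have "\<dots> = (\<integral>\<^sup>+ j. (\<integral>\<^sup>+ x. ennreal (G (fst j)) \<partial>unif) \<partial>measure_pmf Q)"
  proof -
    have "(\<lambda>\<omega>. ennreal (G (fst (fst \<omega>)))) \<in> borel_measurable (measure_pmf Q \<Otimes>\<^sub>M unif)"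
      by measurable
    from unif.nn_integral_fst[OF this] show ?thesis by (simp add: \<Omega>_def)
  qed
  also have "\<dots> = (\<integral>\<^sup>+ j. ennreal (G (fst j)) \<partial>measure_pmf Q)"
    using unif.emeasure_space_1 by simp
  also have "\<dots> = (\<integral>\<^sup>+ l. ennreal (G l) \<partial>measure_pmf (map_pmf fst Q))"
    by (simp add: nn_integral_map_pmf)
  also have "\<dots> = (\<integral>\<^sup>+ l. ennreal (G l) \<partial>measure_pmf P)"
    by (simp add: Q_def map_fst_pair_pmf)
  also have "\<dots> = (\<Sum>l. ennreal (pmf P l) * ennreal (G l))"
    by (simp add: nn_integral_measure_pmf nn_integral_count_space_nat)
  also have "\<dots> \<le> (\<Sum>l. ennreal (10 powr p / Z * q ^ l))"
  proof (intro suminf_le)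
    fix l
    show "ennreal (pmf P l) * ennreal (G l) \<le> ennreal (10 powr p / Z * q ^ l)"
      using moment_term[of l] w_pos[of l] Z_pos
      by (simp add: pmf_P G_def q_def mult.commute flip: ennreal_mult'')
  qed auto
  also have "\<dots> = ennreal (\<Sum>l. 10 powr p / Z * q ^ l)"
    using q Z_pos by (intro suminf_ennreal2 summable_mult summable_geometric) auto
  finally show ?thesis unfolding finite_Lp_moment_def by (rule le_less_trans) simp
qed

end

theorem theorem1p3:
  fixes p :: real
  assumes "0 < p" and "p < 1"
    and "2 \<le> CARD('n::finite)"
  shows "\<exists>\<epsilon>>0. \<exists>\<mu> :: (real ^ 'n ^ 'n) measure.
    SL_prob \<mu> \<and>
    symmetric_measure \<mu> \<and>
    finite_Lp_moment p \<mu> \<and>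
    no_atoms \<mu> \<and>
    measure_support \<mu> = SL \<and>
    (\<forall>K. compactin SL_quotient K \<longrightarrow>
      liminf (\<lambda>n. ereal (1 / real n *
        (\<Sum>k = 1..n. measure (SL_conv_power \<mu> k) (coset_preimage K)))) \<le> ereal (1 - \<epsilon>))"
proof -
  have "\<exists>a b :: 'n. a \<noteq> b"
  proof (rule ccontr)
    assume "\<not> ?thesis"
    then have "(UNIV :: 'n set) = {undefined}" by auto
    then have "CARD('n) = 1" by (metis card_1_singleton_iff One_nat_def)
    then show False using assms(3) by simp
  qed
  then obtain a b :: 'n where ab: "a \<noteq> b" by blast
  obtain d :: "nat \<Rightarrow> real ^ 'n ^ 'n" where d: "\<And>l. d l \<in> SL" "\<And>l. rational_mat (d l)"
    and dense: "\<And>U. open U \<Longrightarrow> U \<inter> SL \<noteq> {} \<Longrightarrow> \<exists>l. d l \<in> U"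
    using dense_rational_sequence by blast
  have "\<forall>l. \<exists>H. height_le (d l) (2 ^ H)" using rational_height d by blast
  then obtain h where h: "\<And>l. height_le (d l) (2 ^ h l)" by metis
  \<comment> \<open>As \<open>p < 1\<close>, this inequality is a rearrangement of the moment
    condition.\<close>
  obtain c :: nat where c: "p / (1 - p) < real c" using reals_Archimedean2 by blast
  have "real (Suc c) * p < real c"
    using c assms(2) by (simp add: field_simps)
  \<comment> \<open>Each \<open>d l\<close> is placed at the two indices \<open>2 * l\<close> and
    \<open>2 * l + 1\<close>, so the odd indices alone run through the whole dense sequence.\<close>
  then interpret heavy_walk a b "\<lambda>l. d (l div 2)" "\<lambda>l. h (l div 2)" c p
  proof (unfold_locales, goal_cases)
    case (4 U)
    then obtain l where "d l \<in> U" using dense by blast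
    then show ?case by (intro exI[of _ "2 * l + 1"]) simp
  qed (use ab d h assms in auto)
  show ?thesis
    using esc_pos SL_prob_\<mu> symmetric_\<mu> moment_\<mu> no_atoms_\<mu> support_\<mu> liminf_bound by blast
qed

end
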